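(* Let $m\in\mathbb{N}$, let $\alpha>\beta\ge 0$ and let $\mathbf{b}=(b_j)_{j\in\mathbb{N}}$ be a positive sequence. Put $a:=\alpha-\beta>0$ and suppose that $$\begin{cases}\|\mathbf{b}\|_{\ell_1(\mathbb{N})}<1 \ \text{ and }\ \mathbf{b}\in\ell_{m/a}(\mathbb{N}), & \text{if } m/a\le 1,\\ \|\mathbf{b}\|_{\ell_1(\mathbb{N})}\le 1, & \text{if } m/a>1.\end{cases}$$ Then for every $s\in\mathbb{N}$ and every $\varepsilon\in(0,1]$, $$2^m\left(\lfloor\varepsilon^{-1/(\alpha-\beta)}\rfloor-1\right)^m\ \le\ n_\varepsilon(U_s^{\alpha,\mathbf{b}},K_s^\beta)\ \le\ n_\varepsilon(U^{\alpha,\mathbf{b}},K^\beta)\ \le\ 2^m\,C\,\varepsilon^{-m/(\alpha-\beta)},$$ where $$C:=\left(\tfrac32\right)^{2m}\sum_{\mathbf{s}\in\mathbb{F}}\left(\frac{|\mathbf{s}|_1!}{\mathbf{s}!}\,\mathbf{b}^{\mathbf{s}}\right)^{m/(\alpha-\beta)}.$$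
   Context: Index sets. $\mathbb{F}$ is the set of all sequences $\mathbf{s}=(s_j)_{j=1}^\infty$ of nonnegative integers with finite support $\operatorname{supp}(\mathbf{s})$; $\mathbf{s}!:=\prod_j s_j!$, $|\mathbf{s}|_1:=\sum_j s_j$, $\mathbf{b}^{\mathbf{s}}:=\prod_j b_j^{s_j}$, $\mathbf{b}^{-\mathbf{s}}:=\prod_j b_j^{-s_j}$. $\mathbb{Z}^m_*:=\{\mathbf{k}\in\mathbb{Z}^m:k_j\ne0,\ j=1,\dots,m\}$, $|\mathbf{k}|_\infty:=\max_j|k_j|$. Function spaces. $\mathbb{T}^m$ is the $m$-dimensional torus (period $1$ in each variable) with normalized Lebesgue measure; $\mathbb{I}=[-1,1]$; $\mathbb{I}^\infty$ is the set of sequences with entries in $\mathbb{I}$, equipped with the infinite product $\mu$ of the uniform probability measures $\frac12\,dy_j$. $L_2(\mathbb{T}^m\times\mathbb{I}^\infty):=L_2(\mathbb{T}^m)\otimes L_2(\mathbb{I}^\infty,\mu)$. Put $L_{(\mathbf{k},\mathbf{s})}(\mathbf{x},\mathbf{y}):=e_{\mathbf{k}}(\mathbf{x})L_{\mathbf{s}}(\mathbf{y})$ with $e_{\mathbf{k}}(\mathbf{x})=\prod_{j=1}^m e^{2\pi i k_jx_j}$ and $L_{\mathbf{s}}(\mathbf{y})=\prod_{j\in\operatorname{supp}(\mathbf{s})}L_{s_j}(y_j)$, where $L_0,L_1,\dots$ are the univariate Legendre polynomials, orthonormal in $L_2(\mathbb{I},\frac12 dy)$; $\{L_{(\mathbf{k},\mathbf{s})}\}_{(\mathbf{k},\mathbf{s})\in\mathbb{Z}^m\times\mathbb{F}}$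 is an orthonormal basis of $L_2(\mathbb{T}^m\times\mathbb{I}^\infty)$, and $v_{\mathbf{k},\mathbf{s}}:=\langle v,L_{(\mathbf{k},\mathbf{s})}\rangle$. For $(\mathbf{k},\mathbf{s})\in\mathbb{Z}^m_*\times\mathbb{F}$ put $\rho_{\alpha,\mathbf{b}}(\mathbf{k},\mathbf{s}):=|\mathbf{k}|_\infty^{\alpha}\frac{\mathbf{s}!}{|\mathbf{s}|_1!}\mathbf{b}^{-\mathbf{s}}$. The space $A^{\alpha,\mathbf{b}}$ consists of all $v\in L_2(\mathbb{T}^m\times\mathbb{I}^\infty)$ of the form $v=\sum_{(\mathbf{k},\mathbf{s})\in\mathbb{Z}^m_*\times\mathbb{F}}v_{\mathbf{k},\mathbf{s}}L_{(\mathbf{k},\mathbf{s})}$ with $\|v\|_{A^{\alpha,\mathbf{b}}}^2:=\sum_{(\mathbf{k},\mathbf{s})\in\mathbb{Z}^m_*\times\mathbb{F}}\rho_{\alpha,\mathbf{b}}(\mathbf{k},\mathbf{s})^2|v_{\mathbf{k},\mathbf{s}}|^2<\infty$. The space $K^\beta$ consists of all $v\in L_2(\mathbb{T}^m\times\mathbb{I}^\infty)$ of the same form with $\|v\|_{K^\beta}^2:=\sum_{(\mathbf{k},\mathbf{s})\in\mathbb{Z}^m_*\times\mathbb{F}}|\mathbf{k}|_\infty^{2\beta}|v_{\mathbf{k},\mathbf{s}}|^2<\infty$. For $s\in\mathbb{N}$, $L_2(\mathbb{T}^m\times\mathbb{I}^s)$ is regarded as the subspace of $L_2(\mathbb{T}^m\times\mathbb{I}^\infty)$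 of functions depending only on $\mathbf{x},y_1,\dots,y_s$, and $A_s^{\alpha,\mathbf{b}}:=A^{\alpha,\mathbf{b}}\cap L_2(\mathbb{T}^m\times\mathbb{I}^s)$, $K_s^\beta:=K^\beta\cap L_2(\mathbb{T}^m\times\mathbb{I}^s)$ (with the inherited norms). $U^{\alpha,\mathbf{b}}$ and $U_s^{\alpha,\mathbf{b}}$ are the unit balls $\{\|v\|\le1\}$ of $A^{\alpha,\mathbf{b}}$ and $A_s^{\alpha,\mathbf{b}}$. $\varepsilon$-dimension. For a Hilbert space $X$ and $W\subset X$, $n_\varepsilon(W,X):=\inf\{n:\ \exists M_n\subset X \text{ with } \dim M_n\le n,\ \sup_{w\in W}\inf_{v\in M_n}\|w-v\|_X\le\varepsilon\}$, where $M_n$ is a linear manifold (linear subspace) of $X$. *)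

theory Defs
  imports
    "HOL-Probability.Probability"
    "HOL-Computational_Algebra.Polynomial"
    "HOL-Library.Function_Algebras"
begin

text \<open>
  Sequences \<open>(z\<^sub>j)\<close> with \<open>j = 1, 2, \<dots>\<close> are functions on \<^typ>\<open>nat\<close>, and the coordinates of
  \<open>\<int>\<^sup>m\<close> and of the torus are indexed by \<open>{..<m}\<close>; so \<open>z\<^sub>j\<close> is \<open>z (j - 1)\<close>.
\<close>

subsection \<open>Index sets\<close>

definition supp :: "(nat \<Rightarrow> nat) \<Rightarrow> nat set"
  where "supp s = {j. s j \<noteq> 0}"

definition FS :: "(nat \<Rightarrow> nat) set"
  where "FS = {s. finite (supp s)}"

definition mi_fact :: "(nat \<Rightarrow> nat) \<Rightarrow> real"
  where "mi_fact s = (\<Prod>j\<in>supp s. fact (s j))"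

definition mi_size :: "(nat \<Rightarrow> nat) \<Rightarrow> nat"
  where "mi_size s = (\<Sum>j\<in>supp s. s j)"

definition mi_pow :: "(nat \<Rightarrow> real) \<Rightarrow> (nat \<Rightarrow> nat) \<Rightarrow> real"
  where "mi_pow b s = (\<Prod>j\<in>supp s. b j ^ s j)"

definition mi_pow_neg :: "(nat \<Rightarrow> real) \<Rightarrow> (nat \<Rightarrow> nat) \<Rightarrow> real"
  where "mi_pow_neg b s = (\<Prod>j\<in>supp s. b j powi (- int (s j)))"

definition Zstar :: "nat \<Rightarrow> (nat \<Rightarrow> int) set"
  where "Zstar m = (\<Pi>\<^sub>E j\<in>{..<m}. {n. n \<noteq> 0})"

definition norm_inf :: "nat \<Rightarrow> (nat \<Rightarrow> int) \<Rightarrow> real"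
  where "norm_inf m k = real_of_int (Max ((\<lambda>j. \<bar>k j\<bar>) ` {..<m}))"

subsection \<open>The space \<open>L\<^sub>2\<close> over the torus times the (infinite-dimensional) cube\<close>

text \<open>
  The torus in one variable is \<open>[0,1)\<close> with Lebesgue measure. In each variable the underlying
  measurable space is the real line, the measure being concentrated on \<open>[0,1)\<close> or \<open>[-1,1]\<close>.
\<close>

definition torus :: "nat \<Rightarrow> (nat \<Rightarrow> real) measure"
  where "torus m = (\<Pi>\<^sub>M j\<in>{..<m}. uniform_measure lborel {0..<1})"

definition cube :: "nat set \<Rightarrow> (nat \<Rightarrow> real) measure"
  where "cube J = (\<Pi>\<^sub>M j\<in>J. uniform_measure lborel {-1..1})"

definition TI :: "nat \<Rightarrow> ((nat \<Rightarrow> real) \<times> (nat \<Rightarrow> real)) measure"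
  where "TI m = torus m \<Otimes>\<^sub>M cube UNIV"

text \<open>
  Elements of \<open>L\<^sub>2\<close> and of its subspaces are represented by functions. All norms and
  coefficients below are unchanged when a function is modified on a null set (remaining
  measurable), and all the sets of functions defined from them are closed under such modifications.
\<close>

definition L2 :: "'a measure \<Rightarrow> ('a \<Rightarrow> complex) set"
  where "L2 M = {v. v \<in> borel_measurable M \<and> integrable M (\<lambda>z. (cmod (v z))\<^sup>2)}"

definition L2_norm :: "'a measure \<Rightarrow> ('a \<Rightarrow> complex) \<Rightarrow> real"
  where "L2_norm M v = sqrt (LINT z|M. (cmod (v z))\<^sup>2)"

definition L2_inner :: "'a measure \<Rightarrow> ('a \<Rightarrow> complex) \<Rightarrow> ('a \<Rightarrow> complex) \<Rightarrow> complex"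
  where "L2_inner M v w = (LINT z|M. v z * cnj (w z))"

text \<open>
  Rodrigues' formula; the factor \<open>sqrt (2 n + 1)\<close> normalizes in \<open>L\<^sub>2([-1,1], dy/2)\<close>.
\<close>

definition legendre :: "nat \<Rightarrow> real poly"
  where "legendre n =
    smult (sqrt (2 * real n + 1) / (2 ^ n * fact n)) ((pderiv ^^ n) ([:-1, 0, 1:] ^ n))"

definition trig :: "nat \<Rightarrow> (nat \<Rightarrow> int) \<Rightarrow> (nat \<Rightarrow> real) \<Rightarrow> complex"
  where "trig m k x = (\<Prod>j<m. exp (2 * of_real pi * \<i> * of_int (k j) * of_real (x j)))"

definition legendre_prod :: "(nat \<Rightarrow> nat) \<Rightarrow> (nat \<Rightarrow> real) \<Rightarrow> real"
  where "legendre_prod s y = (\<Prod>j\<in>supp s. poly (legendre (s j)) (y j))"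

definition basis_fun ::
    "nat \<Rightarrow> (nat \<Rightarrow> int) \<times> (nat \<Rightarrow> nat) \<Rightarrow> (nat \<Rightarrow> real) \<times> (nat \<Rightarrow> real) \<Rightarrow> complex"
  where "basis_fun m = (\<lambda>(k, s) (x, y). trig m k x * of_real (legendre_prod s y))"

definition coeff ::
    "nat \<Rightarrow> ((nat \<Rightarrow> real) \<times> (nat \<Rightarrow> real) \<Rightarrow> complex) \<Rightarrow> (nat \<Rightarrow> int) \<times> (nat \<Rightarrow> nat) \<Rightarrow> complex"
  where "coeff m v p = L2_inner (TI m) v (basis_fun m p)"

text \<open>
  The functions in \<open>L\<^sub>2\<close> that are the sum of their expansion over \<open>Zstar m \<times> FS\<close>, with
  (unconditional) convergence of the series in \<open>L\<^sub>2\<close>.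
\<close>

definition L2_star :: "nat \<Rightarrow> ((nat \<Rightarrow> real) \<times> (nat \<Rightarrow> real) \<Rightarrow> complex) set"
  where "L2_star m = {v \<in> L2 (TI m).
    ((\<lambda>P. L2_norm (TI m) (\<lambda>z. v z - (\<Sum>p\<in>P. coeff m v p * basis_fun m p z))) \<longlongrightarrow> 0)
      (finite_subsets_at_top (Zstar m \<times> FS))}"

text \<open>\<open>L\<^sub>2\<close> over the torus times the \<open>s\<close>-dimensional cube, as a subspace.\<close>

definition L2_trunc :: "nat \<Rightarrow> nat \<Rightarrow> ((nat \<Rightarrow> real) \<times> (nat \<Rightarrow> real) \<Rightarrow> complex) set"
  where "L2_trunc m s = {v \<in> L2 (TI m).
    \<exists>g \<in> L2 (torus m \<Otimes>\<^sub>M cube {..<s}). AE (x, y) in TI m. v (x, y) = g (x, restrict y {..<s})}"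

subsection \<open>The spaces \<open>A\<close> and \<open>K\<close>\<close>

definition rho :: "nat \<Rightarrow> real \<Rightarrow> (nat \<Rightarrow> real) \<Rightarrow> (nat \<Rightarrow> int) \<times> (nat \<Rightarrow> nat) \<Rightarrow> real"
  where "rho m \<alpha> b = (\<lambda>(k, s).
    norm_inf m k powr \<alpha> * (mi_fact s / fact (mi_size s)) * mi_pow_neg b s)"

definition A_space ::
    "nat \<Rightarrow> real \<Rightarrow> (nat \<Rightarrow> real) \<Rightarrow> ((nat \<Rightarrow> real) \<times> (nat \<Rightarrow> real) \<Rightarrow> complex) set"
  where "A_space m \<alpha> b = {v \<in> L2_star m.
    (\<lambda>p. (rho m \<alpha> b p)\<^sup>2 * (cmod (coeff m v p))\<^sup>2) summable_on (Zstar m \<times> FS)}"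

definition A_norm ::
    "nat \<Rightarrow> real \<Rightarrow> (nat \<Rightarrow> real) \<Rightarrow> ((nat \<Rightarrow> real) \<times> (nat \<Rightarrow> real) \<Rightarrow> complex) \<Rightarrow> real"
  where "A_norm m \<alpha> b v =
    sqrt (\<Sum>\<^sub>\<infinity>p\<in>Zstar m \<times> FS. (rho m \<alpha> b p)\<^sup>2 * (cmod (coeff m v p))\<^sup>2)"

definition K_space :: "nat \<Rightarrow> real \<Rightarrow> ((nat \<Rightarrow> real) \<times> (nat \<Rightarrow> real) \<Rightarrow> complex) set"
  where "K_space m \<beta> = {v \<in> L2_star m.
    (\<lambda>(k, s). norm_inf m k powr (2 * \<beta>) * (cmod (coeff m v (k, s)))\<^sup>2)
      summable_on (Zstar m \<times> FS)}"

definition K_norm :: "nat \<Rightarrow> real \<Rightarrow> ((nat \<Rightarrow> real) \<times> (nat \<Rightarrow> real) \<Rightarrow> complex) \<Rightarrow> real"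
  where "K_norm m \<beta> v =
    sqrt (\<Sum>\<^sub>\<infinity>(k, s)\<in>Zstar m \<times> FS. norm_inf m k powr (2 * \<beta>) * (cmod (coeff m v (k, s)))\<^sup>2)"

definition A_trunc ::
    "nat \<Rightarrow> nat \<Rightarrow> real \<Rightarrow> (nat \<Rightarrow> real) \<Rightarrow> ((nat \<Rightarrow> real) \<times> (nat \<Rightarrow> real) \<Rightarrow> complex) set"
  where "A_trunc m s \<alpha> b = A_space m \<alpha> b \<inter> L2_trunc m s"

definition K_trunc ::
    "nat \<Rightarrow> nat \<Rightarrow> real \<Rightarrow> ((nat \<Rightarrow> real) \<times> (nat \<Rightarrow> real) \<Rightarrow> complex) set"
  where "K_trunc m s \<beta> = K_space m \<beta> \<inter> L2_trunc m s"

definition U_ball ::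
    "nat \<Rightarrow> real \<Rightarrow> (nat \<Rightarrow> real) \<Rightarrow> ((nat \<Rightarrow> real) \<times> (nat \<Rightarrow> real) \<Rightarrow> complex) set"
  where "U_ball m \<alpha> b = {v \<in> A_space m \<alpha> b. A_norm m \<alpha> b v \<le> 1}"

definition U_trunc ::
    "nat \<Rightarrow> nat \<Rightarrow> real \<Rightarrow> (nat \<Rightarrow> real) \<Rightarrow> ((nat \<Rightarrow> real) \<times> (nat \<Rightarrow> real) \<Rightarrow> complex) set"
  where "U_trunc m s \<alpha> b = {v \<in> A_trunc m s \<alpha> b. A_norm m \<alpha> b v \<le> 1}"

subsection \<open>The \<open>\<epsilon>\<close>-dimension\<close>

definition cfun_scale :: "complex \<Rightarrow> ('a \<Rightarrow> complex) \<Rightarrow> 'a \<Rightarrow> complex"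
  where "cfun_scale c f = (\<lambda>z. c * f z)"

interpretation cfun: vector_space cfun_scale
  by unfold_locales (auto simp: cfun_scale_def fun_eq_iff algebra_simps)

text \<open>
  \<open>eps_dim \<epsilon> W X N\<close> is the \<open>\<epsilon>\<close>-dimension of \<open>W\<close> in the space \<open>X\<close> normed by \<open>N\<close>; it is \<open>\<infinity>\<close>
  if no finite-dimensional subspace of \<open>X\<close> approximates \<open>W\<close> up to \<open>\<epsilon>\<close>. That the dimension of
  \<open>M\<close> is at most \<open>n\<close> is expressed by a spanning set of at most \<open>n\<close> functions, since the
  function \<open>cfun.dim\<close> of the library is \<open>0\<close> on infinite-dimensional spaces. As elements of \<open>X\<close>
  are representatives modulo null functions, choosing representatives of a basis shows that this
  gives the same number as dimensions of spaces of classes.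
\<close>

definition eps_dim ::
    "real \<Rightarrow> ('a \<Rightarrow> complex) set \<Rightarrow> ('a \<Rightarrow> complex) set \<Rightarrow> (('a \<Rightarrow> complex) \<Rightarrow> real) \<Rightarrow> enat"
  where "eps_dim \<epsilon> W X N = Inf {enat n | n. \<exists>M \<subseteq> X. cfun.subspace M \<and>
    (\<exists>B. finite B \<and> card B \<le> n \<and> cfun.span B = M) \<and>
    (SUP w\<in>W. INF v\<in>M. ereal (N (w - v))) \<le> ereal \<epsilon>}"

end

theory Submission imports Defs begin

text \<open>
  In the coordinates \<open>v(k, t)\<close> both norms are weighted \<open>\<ell>\<^sub>2\<close> norms, so the unit ball is an ellipsoid. Its
  semi-axis in the direction \<open>(k, t)\<close>, measured in \<open>K\<close>, is \<open>|k|\<^sup>\<beta> / \<rho>(k, t) = |k|^(-a) c(t)\<close> with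
  \<open>a = \<alpha> - \<beta>\<close> and \<open>c(t) = |t|! / t! b\<^sup>t\<close>. The \<open>\<epsilon>\<close>-dimension of an ellipsoid is exactly the number of
  its semi-axes that exceed \<open>\<epsilon>\<close>. For the upper bound \<open>eps_dim_le_card\<close> one keeps these coordinates and
  drops the others. For the lower bound \<open>card_le_eps_dim\<close> (Tikhomirov's argument) one takes a subspace
  with fewer dimensions than there are long semi-axes: some nonzero vector in the span of these axes is
  orthogonal to it, and, normalized to lie on the boundary of the ellipsoid, it stays at distance
  more than \<open>\<epsilon>\<close> from the subspace.

  For a function of \<open>x, y\<^sub>1, \<dots>, y\<^sub>s\<close> all coefficients vanish whose \<open>supp t\<close> is not contained in the first
  \<open>s\<close> variables (\<open>coeff_eq_0_if_trunc\<close>), so the truncated ball is the sub-ellipsoid on the other index pairs, and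
  the inequality between the two \<open>\<epsilon>\<close>-dimensions is an inclusion of finite index sets. It remains to
  count the pairs with \<open>|k|\<^sup>a < c(t) / \<epsilon>\<close>. Those with \<open>t = 0\<close>, where \<open>c = 1\<close>, give the lower estimate
  (\<open>card_threshold_ge\<close>). In general there are at most \<open>2\<^sup>m (c(t) / \<epsilon>)\<^sup>p\<close> of them for each \<open>t\<close>, where
  \<open>p = m / a\<close>, and summation over \<open>t\<close> gives the upper estimate (\<open>card_threshold_le\<close>).

  The series \<open>\<Sum> c(t)\<^sup>p\<close> is treated by the multinomial theorem, by which the sum of \<open>c\<close> over
  \<open>|t| = n\<close> is at most \<open>(\<Sum> b)\<^sup>n\<close>. For \<open>p \<le> 1\<close> one splits \<open>b\<^sub>j\<^sup>p = h\<^sub>j\<^sup>p g\<^sub>j^(1-p)\<close> and uses Young's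
  inequality (\<open>multinom_powr_summable_le_1\<close>). For \<open>p > 1\<close> the sum of \<open>b\<close> may be \<open>1\<close>, and then
  there is no geometric decay. But \<open>c(t)\<close> is a multinomial probability with infinitely many cells of
  positive mass, so it spreads out: \<open>c(t) = O(n^(-d/2))\<close> on \<open>|t| = n\<close> for every \<open>d\<close>
  (\<open>multinom_square_decay\<close>), and \<open>\<Sum> c(t)\<^sup>p\<close> over \<open>|t| = n\<close> is at most \<open>max c^(p-1)\<close>
  (\<open>multinom_powr_summable_gt_1\<close>).
\<close>

section \<open>Multinomial weights\<close>

text \<open>
  If \<open>b\<close> sums to \<open>1\<close>, this is the probability of the counts \<open>s\<close> in \<open>|s|\<close> independent trials with
  outcome probabilities \<open>b\<close>; its reciprocal is the factor of \<^const>\<open>rho\<close> that depends on \<open>s\<close>.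
\<close>

definition multinom :: "(nat \<Rightarrow> real) \<Rightarrow> (nat \<Rightarrow> nat) \<Rightarrow> real"
  where "multinom b s = fact (mi_size s) / mi_fact s * mi_pow b s"

lemma mi_size_eq: "finite J \<Longrightarrow> supp s \<subseteq> J \<Longrightarrow> mi_size s = (\<Sum>j\<in>J. s j)"
  unfolding mi_size_def by (rule sum.mono_neutral_left) (auto simp: supp_def)

lemma mi_fact_eq: "finite J \<Longrightarrow> supp s \<subseteq> J \<Longrightarrow> mi_fact s = (\<Prod>j\<in>J. fact (s j))"
  unfolding mi_fact_def by (rule prod.mono_neutral_left) (auto simp: supp_def)

lemma mi_pow_eq: "finite J \<Longrightarrow> supp s \<subseteq> J \<Longrightarrow> mi_pow b s = (\<Prod>j\<in>J. b j ^ s j)"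
  unfolding mi_pow_def by (rule prod.mono_neutral_left) (auto simp: supp_def)

lemma mi_fact_pos: "mi_fact s > 0"
  unfolding mi_fact_def by (intro prod_pos) auto

lemma mi_pow_pos: "(\<And>j. b j > 0) \<Longrightarrow> mi_pow b s > 0"
  unfolding mi_pow_def by (intro prod_pos) auto

lemma mi_pow_nonneg: "(\<And>j. b j \<ge> 0) \<Longrightarrow> mi_pow b s \<ge> 0"
  unfolding mi_pow_def by (intro prod_nonneg) auto

lemma multinom_pos: "(\<And>j. b j > 0) \<Longrightarrow> multinom b s > 0"
  unfolding multinom_def using mi_fact_pos mi_pow_pos by simp

lemma multinom_nonneg: "(\<And>j. b j \<ge> 0) \<Longrightarrow> multinom b s \<ge> 0"
  unfolding multinom_def using mi_fact_pos[of s] mi_pow_nonneg[of b s] by simp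

lemma multinom_size_0: "s \<in> FS \<Longrightarrow> mi_size s = 0 \<Longrightarrow> multinom b s = 1"
  by (auto simp: multinom_def mi_size_def FS_def mi_fact_def mi_pow_def)

lemma FS_upd: "s \<in> FS \<Longrightarrow> s(j := n) \<in> FS"
  unfolding FS_def supp_def
  by (auto intro: finite_subset[of _ "insert j {i. s i \<noteq> 0}"])

lemma multinom_decrement:
  assumes s: "s \<in> FS" and j: "s j > 0"
  defines "s' \<equiv> s(j := s j - 1)"
  shows "mi_size s = Suc (mi_size s')"
    and "real (mi_size s) * (b j * multinom b s') = real (s j) * multinom b s"
proof -
  let ?J = "supp s - {j}"
  have f: "finite (supp s)" and jm: "j \<in> supp s" using s j by (auto simp: FS_def supp_def)
  have s'J: "supp s' \<subseteq> supp s" by (auto simp: s'_def supp_def split: if_splits)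
  have e: "s' i = s i" if "i \<in> ?J" for i using that by (auto simp: s'_def)
  have sj: "s' j = s j - 1" by (simp add: s'_def)
  have "mi_size s' = s' j + (\<Sum>i\<in>?J. s i)"
    unfolding mi_size_eq[OF f s'J] by (subst sum.remove[OF f jm]) (use e in auto)
  moreover have "mi_size s = s j + (\<Sum>i\<in>?J. s i)"
    unfolding mi_size_def by (rule sum.remove[OF f jm])
  ultimately show size: "mi_size s = Suc (mi_size s')" using j sj by simp
  have F': "mi_fact s' = fact (s j - 1) * (\<Prod>i\<in>?J. fact (s i))"
    unfolding mi_fact_eq[OF f s'J] by (subst prod.remove[OF f jm]) (use e sj in auto)
  have F: "mi_fact s = fact (s j) * (\<Prod>i\<in>?J. fact (s i))"
    unfolding mi_fact_def by (rule prod.remove[OF f jm])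
  have P': "mi_pow b s' = b j ^ (s j - 1) * (\<Prod>i\<in>?J. b i ^ s i)"
    unfolding mi_pow_eq[OF f s'J] by (subst prod.remove[OF f jm]) (use e sj in auto)
  have P: "mi_pow b s = b j ^ s j * (\<Prod>i\<in>?J. b i ^ s i)"
    unfolding mi_pow_def by (rule prod.remove[OF f jm])
  obtain k where k: "s j = Suc k" using j by (metis gr0_conv_Suc)
  have nz: "(\<Prod>i\<in>?J. fact (s i) :: real) \<noteq> 0" using f by (simp add: prod_zero_iff)
  show "real (mi_size s) * (b j * multinom b s') = real (s j) * multinom b s"
    unfolding multinom_def F F' P P' size k using nz
    by (simp add: divide_simps del: of_nat_Suc)
qed

text \<open>
  In terms of words with letter counts \<open>s\<close>: a sum over the last letter of the word.
\<close>

lemma multinom_recursion: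
  assumes s: "s \<in> FS" and n: "mi_size s \<noteq> 0"
  shows "multinom b s = (\<Sum>j\<in>supp s. b j * multinom b (s(j := s j - 1)))"
proof -
  have "real (mi_size s) * (\<Sum>j\<in>supp s. b j * multinom b (s(j := s j - 1)))
      = (\<Sum>j\<in>supp s. real (s j) * multinom b s)"
    unfolding sum_distrib_left
    using multinom_decrement(2)[OF s] by (intro sum.cong) (auto simp: supp_def)
  also have "\<dots> = real (mi_size s) * multinom b s"
    by (simp add: mi_size_def sum_distrib_right)
  finally show ?thesis using n by simp
qed

text \<open>
  An inequality form of the multinomial theorem that allows infinitely many letters. Induction on
  the word length by \<open>multinom_recursion\<close>: removing the letter \<open>j\<close> is injective on the count vectors
  that contain it, so every letter \<open>j\<close> contributes at most \<open>b j\<close> times the bound for length \<open>n\<close>.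
\<close>

lemma sum_multinom_le:
  fixes b :: "nat \<Rightarrow> real"
  assumes b: "\<And>j. b j \<ge> 0" and sb: "summable b"
    and F: "finite F" "F \<subseteq> {s \<in> FS. mi_size s = n}"
  shows "(\<Sum>s\<in>F. multinom b s) \<le> suminf b ^ n"
  using F
proof (induction n arbitrary: F)
  case 0
  have "F \<subseteq> {\<lambda>_. 0}"
    using 0 by (auto simp: mi_size_def FS_def supp_def fun_eq_iff)
  hence "F = {} \<or> F = {\<lambda>_. 0}" by auto
  thus ?case by (auto simp: multinom_def mi_size_def mi_fact_def mi_pow_def supp_def)
next
  case (Suc n)
  define J where "J = (\<Union>s\<in>F. supp s)"
  have fJ: "finite J" using Suc.prems by (auto simp: J_def FS_def)
  let ?d = "\<lambda>j s. s(j := s j - 1 :: nat)"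
  have "(\<Sum>s\<in>F. multinom b s) = (\<Sum>s\<in>F. \<Sum>j\<in>supp s. b j * multinom b (?d j s))"
    using Suc.prems by (intro sum.cong refl multinom_recursion) auto
  also have "\<dots> = (\<Sum>s\<in>F. \<Sum>j\<in>J. if s j > 0 then b j * multinom b (?d j s) else 0)"
    using fJ by (intro sum.cong refl sum.mono_neutral_cong_left) (auto simp: J_def supp_def)
  also have "\<dots> = (\<Sum>j\<in>J. \<Sum>s\<in>F. if s j > 0 then b j * multinom b (?d j s) else 0)"
    by (rule sum.swap)
  also have "\<dots> = (\<Sum>j\<in>J. b j * (\<Sum>s\<in>{s\<in>F. s j > 0}. multinom b (?d j s)))"
    using Suc.prems by (intro sum.cong refl)
      (auto simp: sum_distrib_left sum.inter_filter intro!: sum.mono_neutral_cong_right)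
  also have "\<dots> \<le> (\<Sum>j\<in>J. b j * suminf b ^ n)"
  proof (intro sum_mono mult_left_mono b)
    fix j
    have inj: "inj_on (?d j) {s\<in>F. s j > 0}"
    proof (rule inj_onI)
      fix s t assume "s \<in> {s\<in>F. s j > 0}" "t \<in> {s\<in>F. s j > 0}" and eq: "?d j s = ?d j t"
      hence pos: "s j > 0" "t j > 0" by auto
      show "s = t"
      proof
        fix i show "s i = t i" using fun_cong[OF eq, of i] pos by (cases "i = j") auto
      qed
    qed
    have "(\<Sum>s\<in>{s\<in>F. s j > 0}. multinom b (?d j s)) = (\<Sum>s\<in>?d j ` {s\<in>F. s j > 0}. multinom b s)"
      by (subst sum.reindex[OF inj]) (simp add: o_def)
    also have "\<dots> \<le> suminf b ^ n"
    proof (rule Suc.IH)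
      show "?d j ` {s\<in>F. s j > 0} \<subseteq> {s \<in> FS. mi_size s = n}"
      proof safe
        fix s assume s: "s \<in> F" "s j > 0"
        thus "?d j s \<in> FS" using Suc.prems by (auto intro: FS_upd)
        show "mi_size (?d j s) = n" using multinom_decrement(1)[of s j] s Suc.prems by auto
      qed
    qed (use Suc.prems in auto)
    finally show "(\<Sum>s\<in>{s\<in>F. s j > 0}. multinom b (?d j s)) \<le> suminf b ^ n" .
  qed
  also have "\<dots> = (\<Sum>j\<in>J. b j) * suminf b ^ n" by (simp add: sum_distrib_right)
  also have "\<dots> \<le> suminf b * suminf b ^ n"
    by (intro mult_right_mono sum_le_suminf sb fJ zero_le_power suminf_nonneg) (auto intro: b)
  finally show ?case by simp
qed

lemma multinom_le_power:
  assumes b: "\<And>j. b j \<ge> 0" and sb: "summable b" and s: "s \<in> FS"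
  shows "multinom b s \<le> suminf b ^ mi_size s"
  using sum_multinom_le[OF b sb, of "{s}" "mi_size s"] s by simp

lemma multinom_le_1:
  assumes b: "\<And>j. b j \<ge> 0" and sb: "summable b" and le: "suminf b \<le> 1" and s: "s \<in> FS"
  shows "multinom b s \<le> 1"
  using multinom_le_power[OF b sb s] power_le_one[OF suminf_nonneg[OF sb b] le, of "mi_size s"]
  by simp

lemma summable_on_FS_by_size:
  fixes f :: "(nat \<Rightarrow> nat) \<Rightarrow> real"
  assumes f: "\<And>s. s \<in> FS \<Longrightarrow> f s \<ge> 0" and g: "summable g" 
    and le: "\<And>n F. finite F \<Longrightarrow> F \<subseteq> {s \<in> FS. mi_size s = n} \<Longrightarrow> (\<Sum>s\<in>F. f s) \<le> g n"
  shows "f summable_on FS"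
proof (rule nonneg_bdd_above_summable_on)
  have g0: "g n \<ge> 0" for n using le[of "{}" n] by simp
  have "sum f F \<le> suminf g" if F: "F \<subseteq> FS" "finite F" for F
  proof -
    have "sum f F = (\<Sum>n\<in>mi_size ` F. \<Sum>s\<in>{s \<in> F. mi_size s = n}. f s)"
      using F by (subst sum.group) auto
    also have "\<dots> \<le> (\<Sum>n\<in>mi_size ` F. g n)"
      using F by (intro sum_mono le) auto
    also have "\<dots> \<le> suminf g" using F g g0 by (intro sum_le_suminf) auto
    finally show ?thesis .
  qed
  thus "bdd_above (sum f ` {F. F \<subseteq> FS \<and> finite F})" by (auto intro!: bdd_aboveI2)
qed (use f in auto)

lemma multinom_summable:
  assumes b: "\<And>j. b j \<ge> 0" and sb: "summable b" and lt: "suminf b < 1"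
  shows "multinom b summable_on FS"
proof (rule summable_on_FS_by_size)
  show "summable (\<lambda>n. suminf b ^ n)"
    using lt suminf_nonneg[OF sb b] by (intro summable_geometric) auto
qed (auto intro: multinom_nonneg b sum_multinom_le sb)

text \<open>
  The Euler product \<open>\<Prod>\<^sub>j 1 / (1 - g\<^sub>j)\<close> expands to this series, and it converges since its factors
  are at most \<open>exp (g\<^sub>j / (1 - g\<^sub>j))\<close>.
\<close>

lemma mi_pow_summable:
  fixes g :: "nat \<Rightarrow> real"
  assumes g: "\<And>j. g j \<ge> 0" and lt: "\<And>j. g j < 1" and sg: "summable g"
  shows "mi_pow g summable_on FS"
proof (rule nonneg_bdd_above_summable_on)
  obtain N where N: "\<And>j. j \<ge> N \<Longrightarrow> g j < 1 / 2"
    using order_tendstoD(2)[OF summable_LIMSEQ_zero[OF sg], of "1/2"]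
    by (auto simp: eventually_sequentially)
  define h where "h j = g j / (1 - g j)" for j
  have h0: "h j \<ge> 0" for j unfolding h_def using g[of j] lt[of j] by simp
  have "summable h"
  proof (rule summable_comparison_test')
    show "summable (\<lambda>j. 2 * g j)" using sg by (rule summable_mult)
    fix j assume "j \<ge> N"
    hence "g j < 1 / 2" by (rule N)
    moreover have "g j * (1 / 2) \<le> g j * (1 - g j)" 
      using \<open>g j < 1 / 2\<close> g[of j] by (intro mult_left_mono) auto
    ultimately show "norm (h j) \<le> 2 * g j" using g[of j] lt[of j] 
      unfolding h_def by (simp add: divide_simps)
  qed
  have "sum (mi_pow g) F \<le> exp (suminf h)" if F: "F \<subseteq> FS" "finite F" for F
  proof -
    define J where "J = (\<Union>s\<in>F. supp s)"
    have fJ: "finite J" using F by (auto simp: J_def FS_def)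
    define L where "L = Max ((\<lambda>(s, j). s j) ` (F \<times> J))"
    have L: "s j \<le> L" if "s \<in> F" "j \<in> J" for s j
      unfolding L_def using that F fJ by (intro Max_ge) force+
    have inj: "inj_on (\<lambda>s. restrict s J) F"
    proof (rule inj_onI)
      fix s t assume st: "s \<in> F" "t \<in> F" and eq: "restrict s J = restrict t J"
      show "s = t"
      proof
        fix j
        show "s j = t j"
        proof (cases "j \<in> J")
          case True thus ?thesis using fun_cong[OF eq, of j] by simp
        next
          case False 
          hence "s j = 0" "t j = 0" using st by (auto simp: J_def supp_def)
          thus ?thesis by simp
        qed
      qed
    qed
    have "sum (mi_pow g) F = (\<Sum>s\<in>F. \<Prod>j\<in>J. g j ^ s j)"
      by (intro sum.cong refl mi_pow_eq fJ) (auto simp: J_def)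
    also have "\<dots> = (\<Sum>t\<in>(\<lambda>s. restrict s J) ` F. \<Prod>j\<in>J. g j ^ t j)"
      by (subst sum.reindex[OF inj]) auto
    also have "\<dots> \<le> (\<Sum>t\<in>PiE J (\<lambda>_. {..L}). \<Prod>j\<in>J. g j ^ t j)"
      using fJ L g by (intro sum_mono2 finite_PiE prod_nonneg) auto
    also have "\<dots> = (\<Prod>j\<in>J. \<Sum>l\<le>L. g j ^ l)"
      using fJ by (subst prod_sum_PiE) auto
    also have "\<dots> \<le> (\<Prod>j\<in>J. exp (h j))"
    proof (intro prod_mono conjI sum_nonneg zero_le_power g)
      fix j
      have "(\<Sum>l\<le>L. g j ^ l) \<le> (\<Sum>l. g j ^ l)"
        using g[of j] lt[of j] by (intro sum_le_suminf summable_geometric) auto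
      also have "\<dots> = 1 / (1 - g j)"
        using g[of j] lt[of j] by (intro suminf_geometric) auto
      also have "\<dots> = 1 + h j" using lt[of j] by (simp add: h_def field_simps)
      also have "\<dots> \<le> exp (h j)" by (rule exp_ge_add_one_self)
      finally show "(\<Sum>l\<le>L. g j ^ l) \<le> exp (h j)" .
    qed
    also have "\<dots> = exp (\<Sum>j\<in>J. h j)" by (simp add: exp_sum fJ)
    also have "\<dots> \<le> exp (suminf h)"
      using \<open>summable h\<close> fJ h0 by (simp add: sum_le_suminf)
    finally show ?thesis .
  qed
  thus "bdd_above (sum (mi_pow g) ` {F. F \<subseteq> FS \<and> finite F})" by (auto intro!: bdd_aboveI2)
qed (use g in \<open>auto intro: mi_pow_nonneg\<close>)

section \<open>Decay of multinomial probabilities\<close>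

text \<open>
  De Moivre's identity, which he used for the mean absolute deviation of the binomial distribution:
  the partial sums of the first central moment telescope. It expresses a single binomial probability
  through a first moment, which the variance controls.
\<close>

lemma de_Moivre_partial_deviation:
  fixes q :: real
  shows "(\<Sum>j\<le>i. (real (Suc n) * q - real j) * Bernstein (Suc n) j q)
         = real (Suc n) * q * (1 - q) * Bernstein n i q"
proof (induction i)
  case 0
  show ?case by (simp add: Bernstein_def)
next
  case (Suc i)
  have absorb: "real (Suc i) * Bernstein (Suc n) (Suc i) q = real (Suc n) * q * Bernstein n i q"
  proof -
    have "real (Suc i) * real (Suc n choose Suc i) = real (Suc n) * real (n choose i)"
      using Suc_times_binomial[of i n] by (metis of_nat_mult)
    hence "real (Suc i) * real (Suc n choose Suc i) * q ^ Suc i * (1 - q) ^ (n - i)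
         = real (Suc n) * real (n choose i) * q ^ Suc i * (1 - q) ^ (n - i)" by simp
    thus ?thesis by (simp add: Bernstein_def mult_ac del: of_nat_Suc binomial_Suc_Suc)
  qed
  have pascal: "Bernstein (Suc n) (Suc i) q = q * Bernstein n i q + (1 - q) * Bernstein n (Suc i) q"
  proof (cases "Suc i \<le> n")
    case True
    hence "n - i = Suc (n - Suc i)" by simp
    thus ?thesis by (simp add: Bernstein_def algebra_simps)
  next
    case False
    thus ?thesis by (simp add: Bernstein_def algebra_simps not_le binomial_eq_0)
  qed
  have "(real (Suc n) * q - real (Suc i)) * Bernstein (Suc n) (Suc i) q
      = real (Suc n) * q * Bernstein (Suc n) (Suc i) q - real (Suc n) * q * Bernstein n i q"
    using absorb by (simp only: left_diff_distrib)
  also have "\<dots> = real (Suc n) * q * (1 - q) * (Bernstein n (Suc i) q - Bernstein n i q)"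
    unfolding pascal by (simp add: algebra_simps)
  finally show ?case using Suc.IH by (simp add: algebra_simps)
qed

lemma Bernstein_variance:
  "(\<Sum>j\<le>n. (real n * q - real j)\<^sup>2 * Bernstein n j q) = real n * q * (1 - q)"
proof -
  have "(\<Sum>j\<le>n. (real n * q - real j)\<^sup>2 * Bernstein n j q)
      = (\<Sum>j\<le>n. (real n * q)\<^sup>2 * Bernstein n j q + (1 - 2 * real n * q) * (real j * Bernstein n j q)
           + real j * (real j - 1) * Bernstein n j q)"
    by (rule sum.cong) (auto simp: algebra_simps power2_eq_square)
  also have "\<dots> = (real n * q)\<^sup>2 + (1 - 2 * real n * q) * (real n * q)
           + real n * (real n - 1) * q\<^sup>2"
    by (simp only: sum.distrib sum_distrib_left[symmetric] sum_Bernstein sum_k_Bernstein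
          sum_kk_Bernstein mult_1_right)
  also have "\<dots> = real n * q * (1 - q)" by (simp add: algebra_simps power2_eq_square)
  finally show ?thesis .
qed

text \<open>
  A binomial probability is \<open>O(n^(-1/2))\<close>, uniformly in \<open>i\<close>: by de Moivre's identity it is a partial first
  moment divided by \<open>(n + 1) q (1 - q)\<close>, and by Cauchy-Schwarz this moment is at most the standard
  deviation.
\<close>

lemma Bernstein_square_le:
  fixes q :: real
  assumes q: "0 < q" "q < 1"
  shows "(Bernstein n i q)\<^sup>2 \<le> 1 / (real (Suc n) * q * (1 - q))"
proof (cases "i \<le> n")
  case False
  hence "Bernstein n i q = 0" by (simp add: Bernstein_def binomial_eq_0)
  thus ?thesis using q by simp
next
  case True
  define V where "V = real (Suc n) * q * (1 - q)"
  have V: "V > 0" unfolding V_def using q by simp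
  let ?B = "\<lambda>j. Bernstein (Suc n) j q"
  have B0: "?B j \<ge> 0" for j using q by (intro Bernstein_nonneg) auto
  have "(V * Bernstein n i q)\<^sup>2
      = (\<Sum>j\<le>i. ((real (Suc n) * q - real j) * sqrt (?B j)) * sqrt (?B j))\<^sup>2"
    unfolding V_def de_Moivre_partial_deviation[symmetric] using B0
    by (simp add: mult.assoc del: of_nat_Suc)
  also have "\<dots> \<le> (\<Sum>j\<le>i. ((real (Suc n) * q - real j) * sqrt (?B j))\<^sup>2) * (\<Sum>j\<le>i. (sqrt (?B j))\<^sup>2)"
    by (rule Cauchy_Schwarz_ineq_sum)
  also have "\<dots> = (\<Sum>j\<le>i. (real (Suc n) * q - real j)\<^sup>2 * ?B j) * (\<Sum>j\<le>i. ?B j)"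
    using B0 by (simp add: power_mult_distrib del: of_nat_Suc)
  also have "\<dots> \<le> (\<Sum>j\<le>Suc n. (real (Suc n) * q - real j)\<^sup>2 * ?B j) * (\<Sum>j\<le>Suc n. ?B j)"
    using True B0 by (intro mult_mono sum_mono2 sum_nonneg mult_nonneg_nonneg) auto
  also have "\<dots> = V" unfolding Bernstein_variance sum_Bernstein V_def by simp
  finally have "V\<^sup>2 * (Bernstein n i q)\<^sup>2 \<le> V" by (simp add: power_mult_distrib)
  hence "V * (Bernstein n i q)\<^sup>2 \<le> 1" using V by (simp add: power2_eq_square)
  thus ?thesis using V unfolding V_def[symmetric] by (simp add: field_simps)
qed

text \<open>
  The number \<open>n - i\<close> of trials that are left over can be small, and then \<open>(n - i + 1)^(-d)\<close> is no better
  than \<open>1\<close>. But in this case the binomial probability is small too: each factor \<open>1 / (n - i + 1)\<close> is absorbed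
  by the binomial coefficient and becomes, up to a constant, \<open>1 / (n + 1)\<close> at the price of one more trial.
\<close>

lemma Bernstein_div_power:
  fixes q :: real
  assumes q: "0 < q" "q < 1" and i: "i \<le> n"
  shows "Bernstein n i q / real (Suc (n - i)) ^ d
         \<le> fact d / (1 - q) ^ d / real (Suc n) ^ d * Bernstein (n + d) i q"
proof (induction d)
  case 0
  show ?case by simp
next
  case (Suc d)
  have eq: "Bernstein (n + d) i q / real (Suc (n + d - i))
      = Bernstein (n + Suc d) i q / ((1 - q) * real (Suc (n + d)))"
  proof -
    have "real (Suc (n + d - i)) * real (Suc (n + d) choose i) = real (Suc (n + d)) * real (n + d choose i)"
      using binomial_absorb_comp[of "Suc (n + d)" i] i
      by (metis Suc_diff_le diff_Suc_1 of_nat_mult trans_le_add1)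
    hence ratio: "real (n + d choose i) / real (Suc (n + d - i)) = real (Suc (n + d) choose i) / real (Suc (n + d))"
      by (simp add: field_simps del: of_nat_Suc binomial_Suc_Suc)
    have "Bernstein (n + d) i q / real (Suc (n + d - i))
        = real (n + d choose i) / real (Suc (n + d - i)) * (q ^ i * (1 - q) ^ (n + d - i))"
      by (simp add: Bernstein_def)
    also have "\<dots> = Bernstein (n + Suc d) i q / ((1 - q) * real (Suc (n + d)))"
      unfolding ratio using q i by (simp add: Bernstein_def Suc_diff_le del: of_nat_Suc binomial_Suc_Suc)
    finally show ?thesis .
  qed
  have Bn: "Bernstein (n + d) i q \<ge> 0" for d using q by (intro Bernstein_nonneg) auto
  have "Bernstein (n + d) i q / real (Suc (n - i))
      \<le> Bernstein (n + d) i q / (real (Suc (n + d - i)) / real (Suc d))"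
  proof (intro divide_left_mono Bn mult_pos_pos)
    have "Suc (n + d - i) \<le> Suc (n - i) * Suc d" using i by simp
    hence "real (Suc (n + d - i)) \<le> real (Suc (n - i)) * real (Suc d)"
      by (metis of_nat_le_iff of_nat_mult)
    thus "real (Suc (n + d - i)) / real (Suc d) \<le> real (Suc (n - i))"
      by (simp add: divide_le_eq del: of_nat_Suc)
  qed auto
  also have "\<dots> = real (Suc d) * (Bernstein (n + Suc d) i q / ((1 - q) * real (Suc (n + d))))"
    unfolding eq[symmetric] by simp
  also have "\<dots> \<le> real (Suc d) * (Bernstein (n + Suc d) i q / ((1 - q) * real (Suc n)))"
    using q by (intro mult_left_mono divide_left_mono Bn mult_pos_pos) auto
  finally have one: "Bernstein (n + d) i q / real (Suc (n - i))
      \<le> real (Suc d) * (Bernstein (n + Suc d) i q / ((1 - q) * real (Suc n)))" .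
  have "Bernstein n i q / real (Suc (n - i)) ^ Suc d
      = Bernstein n i q / real (Suc (n - i)) ^ d / real (Suc (n - i))" by simp
  also have "\<dots> \<le> fact d / (1 - q) ^ d / real (Suc n) ^ d * Bernstein (n + d) i q / real (Suc (n - i))"
    by (intro divide_right_mono Suc.IH) simp
  also have "\<dots> = fact d / (1 - q) ^ d / real (Suc n) ^ d * (Bernstein (n + d) i q / real (Suc (n - i)))"
    by simp
  also have "\<dots> \<le> fact d / (1 - q) ^ d / real (Suc n) ^ d
      * (real (Suc d) * (Bernstein (n + Suc d) i q / ((1 - q) * real (Suc n))))"
    using q by (intro mult_left_mono one) auto
  finally show ?case using q by (simp add: mult_ac)
qed

text \<open>
  Conditioning on the number of outcomes \<open>i\<close>: it is binomially distributed, and the other outcomes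
  are multinomially distributed with the renormalized probabilities.
\<close>

lemma multinom_remove:
  assumes s: "s \<in> FS" and q: "b i < 1"
  defines "s' \<equiv> s(i := 0)" and "b' \<equiv> \<lambda>j. (b(i := 0)) j / (1 - b i)"
  shows "multinom b s = Bernstein (mi_size s) (s i) (b i) * multinom b' s'"
    and "mi_size s = s i + mi_size s'"
proof -
  define J where "J = supp s - {i}"
  have f: "finite (insert i (supp s))" "finite J" using s by (auto simp: FS_def J_def)
  have sub: "supp s \<subseteq> insert i (supp s)" "supp s' \<subseteq> J" by (auto simp: s'_def J_def supp_def)
  have ins: "insert i (supp s) = insert i J" "i \<notin> J" by (auto simp: J_def)
  have e: "s' j = s j" if "j \<in> J" for j using that by (auto simp: s'_def J_def)
  have size': "mi_size s' = (\<Sum>j\<in>J. s j)"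
    using mi_size_eq[OF f(2) sub(2)] e by simp
  have size1: "mi_size s = s i + (\<Sum>j\<in>J. s j)"
    using mi_size_eq[OF f(1) sub(1)] f(2) ins by simp
  thus size: "mi_size s = s i + mi_size s'" using size' by simp
  have F: "mi_fact s = fact (s i) * mi_fact s'"
    using mi_fact_eq[OF f(1) sub(1)] mi_fact_eq[OF f(2) sub(2)] f(2) ins e by simp
  have P: "mi_pow b s = b i ^ s i * (\<Prod>j\<in>J. b j ^ s j)"
    using mi_pow_eq[OF f(1) sub(1)] f(2) ins by simp
  have "mi_pow b' s' = (\<Prod>j\<in>J. b j ^ s j / (1 - b i) ^ s j)"
    unfolding mi_pow_eq[OF f(2) sub(2)]
    by (rule prod.cong) (auto simp: b'_def e power_divide, auto simp: J_def)
  also have "\<dots> = (\<Prod>j\<in>J. b j ^ s j) / (1 - b i) ^ mi_size s'"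
    by (simp add: prod_dividef size' power_sum)
  finally have P': "(\<Prod>j\<in>J. b j ^ s j) = mi_pow b' s' * (1 - b i) ^ mi_size s'"
    using q by simp
  have ch: "real (mi_size s choose s i) = fact (mi_size s) / (fact (s i) * fact (mi_size s'))"
    using binomial_fact[of "s i" "mi_size s", where 'a=real] size by simp
  show "multinom b s = Bernstein (mi_size s) (s i) (b i) * multinom b' s'"
    unfolding multinom_def Bernstein_def ch F P P' using size mi_fact_pos[of s']
    by (simp add: field_simps)
qed

text \<open>
  Each cell in \<open>D\<close> gains a factor \<open>n^(-1/2)\<close>. In the induction step one cell is split off by
  \<open>multinom_remove\<close>. Squaring leaves two binomial factors: one turns the decay \<open>(n - i + 1)^(-d)\<close> from the
  induction hypothesis into \<open>n^(-d)\<close>, and the product of both gives the new factor \<open>1 / n\<close>. The positive mass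
  outside \<open>D\<close> keeps every split off cell from carrying the whole mass.
\<close>

lemma multinom_square_decay:
  assumes "finite D" "\<And>j. b j \<ge> 0" "summable b" "suminf b \<le> 1" 
    "\<And>j. j \<in> D \<Longrightarrow> b j > 0" "\<exists>j. j \<notin> D \<and> b j > 0"
  shows "\<exists>C. \<forall>s\<in>FS. (multinom b s)\<^sup>2 \<le> C / real (Suc (mi_size s)) ^ card D"
  using assms
proof (induction D arbitrary: b rule: finite_induct)
  case empty
  have "(multinom b s)\<^sup>2 \<le> 1" if "s \<in> FS" for s
    using multinom_le_1[OF empty(1-3) that] multinom_nonneg[OF empty(1)]
    by (simp add: power_le_one)
  thus ?case by (intro exI[of _ 1]) auto
next
  case (insert i D)
  define q where "q = b i"
  obtain k where k: "k \<notin> insert i D" "b k > 0" using insert.prems by auto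
  have "b i + b k = (\<Sum>j\<in>{i, k}. b j)" using k by auto
  also have "\<dots> \<le> suminf b" using insert.prems by (intro sum_le_suminf) auto
  finally have q: "0 < q" "q < 1" using k insert.prems by (auto simp: q_def)
  define b0 where "b0 = (\<lambda>j. (b(i := 0)) j)"
  define b' where "b' = (\<lambda>j. (b(i := 0)) j / (1 - b i))"
  have b'0: "b' = (\<lambda>j. b0 j / (1 - q))" by (simp add: b'_def b0_def q_def)
  have b0_alt: "b0 = (\<lambda>j. b j - (if j = i then b i else 0))" by (auto simp: b0_def)
  have "(\<lambda>j. b j - (if j = i then b i else 0)) sums (suminf b - b i)"
    using insert.prems(2) by (intro sums_diff sums_single summable_sums)
  hence b0_sums: "b0 sums (suminf b - q)" by (simp add: b0_alt q_def)
  hence b'_sums: "b' sums ((suminf b - q) / (1 - q))" unfolding b'0 by (rule sums_divide)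
  have "\<exists>C. \<forall>s\<in>FS. (multinom b' s)\<^sup>2 \<le> C / real (Suc (mi_size s)) ^ card D"
  proof (rule insert.IH)
    show "summable b'" using b'_sums by (rule sums_summable)
    show "suminf b' \<le> 1" using sums_unique[OF b'_sums] insert.prems(3) q by (metis diff_right_mono divide_le_eq_1_pos diff_gt_0_iff_gt)
    show "b' j \<ge> 0" for j using insert.prems(1)[of j] q by (auto simp: b'_def q_def)
    show "b' j > 0" if "j \<in> D" for j
      using insert.prems(4)[of j] q that insert.hyps by (auto simp: b'_def q_def)
    show "\<exists>j. j \<notin> D \<and> b' j > 0"
      using k q by (intro exI[of _ k]) (auto simp: b'_def q_def)
  qed
  then obtain C0 where "\<forall>s\<in>FS. (multinom b' s)\<^sup>2 \<le> C0 / real (Suc (mi_size s)) ^ card D" ..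
  define C where "C = max C0 0"
  have C: "(multinom b' s)\<^sup>2 \<le> C / real (Suc (mi_size s)) ^ card D" if "s \<in> FS" for s
    using \<open>\<forall>s\<in>FS. _\<close> that unfolding C_def
    by (smt (verit) divide_right_mono of_nat_0_le_iff zero_le_power)
  have C0: "C \<ge> 0" by (simp add: C_def)
  define d where "d = card D"
  define K where "K = C * (fact d / (1 - q) ^ d) * (1 / (q * (1 - q)))"
  have "(multinom b s)\<^sup>2 \<le> K / real (Suc (mi_size s)) ^ Suc d" if s: "s \<in> FS" for s
  proof -
    define n where "n = mi_size s"
    define s' where "s' = s(i := 0)"
    let ?B = "Bernstein n (s i) q"
    have m: "multinom b s = ?B * multinom b' s'" and sz: "mi_size s = s i + mi_size s'"
      using multinom_remove[OF s, of b i] q unfolding b'_def s'_def n_def q_def by auto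
    have i: "s i \<le> n" and sz': "mi_size s' = n - s i" using sz by (auto simp: n_def)
    have B0: "Bernstein n (s i) q \<ge> 0" for n using q by (intro Bernstein_nonneg) auto
    have "(multinom b s)\<^sup>2 = ?B\<^sup>2 * (multinom b' s')\<^sup>2" by (simp add: m power_mult_distrib)
    also have "\<dots> \<le> ?B\<^sup>2 * (C / real (Suc (n - s i)) ^ d)"
      using C[of s'] s sz' by (intro mult_left_mono) (auto simp: d_def s'_def FS_upd)
    also have "\<dots> = C * ?B * (?B / real (Suc (n - s i)) ^ d)" by (simp add: power2_eq_square)
    also have "\<dots> \<le> C * ?B * (fact d / (1 - q) ^ d / real (Suc n) ^ d * Bernstein (n + d) (s i) q)"
      by (intro mult_left_mono Bernstein_div_power q i mult_nonneg_nonneg C0 B0)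
    also have "\<dots> = C * (fact d / (1 - q) ^ d) / real (Suc n) ^ d * (?B * Bernstein (n + d) (s i) q)"
      by simp
    also have "\<dots> \<le> C * (fact d / (1 - q) ^ d) / real (Suc n) ^ d * (1 / (real (Suc n) * q * (1 - q)))"
    proof (intro mult_left_mono divide_nonneg_nonneg mult_nonneg_nonneg C0)
      have b1: "(Bernstein (n + e) (s i) q)\<^sup>2 \<le> 1 / (real (Suc n) * q * (1 - q))" for e
      proof -
        have "(Bernstein (n + e) (s i) q)\<^sup>2 \<le> 1 / (real (Suc (n + e)) * q * (1 - q))"
          by (rule Bernstein_square_le[OF q])
        also have "\<dots> \<le> 1 / (real (Suc n) * q * (1 - q))"
          using q by (intro divide_left_mono mult_right_mono mult_pos_pos) auto
        finally show ?thesis .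
      qed
      have "2 * (?B * Bernstein (n + d) (s i) q) \<le> ?B\<^sup>2 + (Bernstein (n + d) (s i) q)\<^sup>2"
        using sum_squares_bound[of ?B "Bernstein (n + d) (s i) q"] by simp
      thus "?B * Bernstein (n + d) (s i) q \<le> 1 / (real (Suc n) * q * (1 - q))"
        using b1[of 0] b1[of d] by simp
    qed (use q in auto)
    also have "\<dots> = K / real (Suc n) ^ Suc d" by (simp add: K_def)
    finally show ?thesis by (simp add: n_def)
  qed
  thus ?case using insert.hyps unfolding d_def by auto
qed

section \<open>Summability of powers of multinomial weights\<close>

text \<open>
  On \<open>|s| = n\<close> the sum of \<open>c\<^sup>p\<close> is at most \<open>max c^(p-1)\<close> times the sum of \<open>c\<close>. The latter is at most \<open>1\<close>,
  and enough cells make the former \<open>O(n^(-2))\<close>.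
\<close>

lemma multinom_powr_summable_gt_1:
  assumes b: "\<And>j. b j > 0" and sb: "summable b" and le: "suminf b \<le> 1" and p: "p > 1"
  shows "(\<lambda>s. multinom b s powr p) summable_on FS"
proof -
  have b0: "b j \<ge> 0" for j using b[of j] by simp
  obtain d :: nat where d: "real d * ((p - 1) / 2) \<ge> 2"
    using real_arch_simple[of "2 / ((p - 1) / 2)"] p by (auto simp: field_simps)
  have "\<exists>C. \<forall>s\<in>FS. (multinom b s)\<^sup>2 \<le> C / real (Suc (mi_size s)) ^ card {..<d}"
    by (rule multinom_square_decay) (use b b0 sb le in \<open>auto intro: exI[of _ d]\<close>)
  then obtain C where C: "\<And>s. s \<in> FS \<Longrightarrow> (multinom b s)\<^sup>2 \<le> C / real (Suc (mi_size s)) ^ d"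
    by auto
  have half: "2 * ((p - 1) / 2) = p - 1" by simp
  have pos: "multinom b s > 0" for s using b by (rule multinom_pos)
  have "(\<lambda>_. 0) \<in> FS" by (simp add: FS_def supp_def)
  from C[OF this] have "C > 0" using pos[of "\<lambda>_. 0"]
    by (smt (verit) divide_nonpos_nonneg of_nat_0_le_iff zero_le_power zero_less_power)
  show ?thesis
  proof (rule summable_on_FS_by_size)
    show "summable (\<lambda>n. C powr ((p - 1) / 2) * (1 / real (Suc n) ^ 2))"
      using inverse_power_summable[of 2, where 'a=real]
      by (intro summable_mult) (subst summable_Suc_iff, simp add: field_simps)
    fix n F assume F: "finite F" "F \<subseteq> {s \<in> FS. mi_size s = n}"
    define A where "A = C powr ((p - 1) / 2) * (1 / real (Suc n) ^ 2)"
    have "multinom b s powr p \<le> A * multinom b s" if s: "s \<in> F" for s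
    proof -
      have "multinom b s powr (p - 1) = ((multinom b s)\<^sup>2) powr ((p - 1) / 2)"
        using pos[of s] powr_powr[of "multinom b s" 2 "(p - 1) / 2", unfolded half] by simp
      also have "\<dots> \<le> (C / real (Suc n) ^ d) powr ((p - 1) / 2)"
        using C[of s] s F p by (intro powr_mono2) auto
      also have "\<dots> = C powr ((p - 1) / 2) / real (Suc n) powr (real d * ((p - 1) / 2))"
        using \<open>C > 0\<close> by (simp add: powr_divide powr_powr del: of_nat_Suc flip: powr_realpow)
      also have "\<dots> \<le> C powr ((p - 1) / 2) / real (Suc n) powr 2"
        using d by (intro divide_left_mono powr_mono mult_pos_pos) auto
      also have "\<dots> = A" by (simp add: A_def)
      finally have "multinom b s powr (p - 1) * multinom b s \<le> A * multinom b s"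
        using pos[of s] by (intro mult_right_mono) auto
      moreover have "multinom b s powr (p - 1) * multinom b s = multinom b s powr p"
        using pos[of s] by (simp add: powr_diff)
      ultimately show ?thesis by simp
    qed
    hence "(\<Sum>s\<in>F. multinom b s powr p) \<le> (\<Sum>s\<in>F. A * multinom b s)" by (rule sum_mono)
    also have "\<dots> = A * (\<Sum>s\<in>F. multinom b s)" by (simp add: sum_distrib_left)
    also have "\<dots> \<le> A * suminf b ^ n"
      by (intro mult_left_mono sum_multinom_le b0 sb F) (simp add: A_def)
    also have "\<dots> \<le> A * 1"
      using le suminf_nonneg[OF sb b0] by (intro mult_left_mono power_le_one) (auto simp: A_def)
    finally show "(\<Sum>s\<in>F. multinom b s powr p) \<le> C powr ((p - 1) / 2) * (1 / real (Suc n) ^ 2)"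
      by (simp add: A_def)
  qed auto
qed

lemma multinom_powr_interpolate:
  assumes b: "\<And>j. b j > 0" and c: "\<And>j. c j > 0" and g: "\<And>j. g j > 0"
    and eq: "\<And>j. b j powr p = c j powr p * g j powr (1 - p)"
  shows "multinom b s powr p = multinom c s powr p * mi_pow g s powr (1 - p)"
proof -
  have pow: "mi_pow h s powr r = (\<Prod>j\<in>supp s. (h j powr r) ^ s j)" if h: "\<And>j. h j > 0"
    for h :: "nat \<Rightarrow> real" and r
  proof -
    have "(h j ^ s j) powr r = (h j powr r) ^ s j" for j
      using h[of j] by (simp add: powr_powr mult.commute flip: powr_realpow)
    thus ?thesis unfolding mi_pow_def using h by (simp add: prod_powr_distrib less_imp_le)
  qed
  have "mi_pow b s powr p = mi_pow c s powr p * mi_pow g s powr (1 - p)"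
    unfolding pow[OF b] pow[OF c] pow[OF g] eq by (simp add: power_mult_distrib prod.distrib)
  thus ?thesis
    using mi_pow_pos[of b s, OF b] mi_pow_pos[of c s, OF c] mi_fact_pos[of s]
    by (simp add: multinom_def powr_mult powr_divide less_imp_le)
qed

text \<open>
  By Young's inequality a splitting \<open>b\<^sub>j\<^sup>p = c\<^sub>j\<^sup>p g\<^sub>j^(1-p)\<close> bounds the power of the multinomial weight of \<open>b\<close> by
  a convex combination of the weight of \<open>c\<close> and of \<open>g\<^sup>s\<close>. The first is summable if \<open>\<Sum> c < 1\<close>, the second
  if \<open>g < 1\<close> and \<open>\<Sum> g < \<infinity>\<close>. On a tail where \<open>\<Sum> b\<^sub>j\<^sup>p\<close> is small one can take \<open>c\<^sub>j = g\<^sub>j = b\<^sub>j\<^sup>p\<close>. On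
  the finite remainder \<open>g\<close> need only be less than \<open>1\<close>, so it suffices to stretch \<open>b\<close> by a factor
  \<open>\<theta> > 1\<close> for which \<open>\<Sum> c\<close> is still less than \<open>1\<close>.
\<close>

lemma multinom_powr_summable_le_1:
  assumes b: "\<And>j. b j > 0" and sb: "summable b" and lt: "suminf b < 1" and p: "0 < p" "p \<le> 1"
    and sp: "summable (\<lambda>j. b j powr p)"
  shows "(\<lambda>s. multinom b s powr p) summable_on FS"
proof (cases "p = 1")
  case True
  thus ?thesis using multinom_summable[OF less_imp_le[OF b] sb lt] multinom_pos[of b, OF b]
    by (simp add: less_imp_le)
next
  case False
  hence p1: "p < 1" using p by simp
  define A where "A = suminf b"
  have A: "0 < A" "A < 1" using suminf_pos[OF sb] b lt by (auto simp: A_def)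
  \<comment> \<open>stretches the total mass from \<open>A\<close> to the midpoint of \<open>A\<close> and \<open>1\<close>\<close>
  define \<theta> where "\<theta> = (1 + A) / (2 * A)"
  have \<theta>: "\<theta> > 1" "\<theta> * A = (1 + A) / 2" using A by (auto simp: \<theta>_def field_simps)
  have "(\<lambda>n. \<Sum>j. b (j + n) powr p) \<longlonglongrightarrow> 0"
    by (rule suminf_exist_split2[OF sp])
  hence "\<forall>\<^sub>F n in sequentially. (\<Sum>j. b (j + n) powr p) < (1 - A) / 2"
    using A by (intro order_tendstoD(2)) auto
  then obtain J where J: "(\<Sum>j. b (j + J) powr p) < (1 - A) / 2"
    by (auto simp: eventually_sequentially)
  have b1: "b j < 1" for j
    using sum_le_suminf[OF sb, of "{j}"] less_imp_le[OF b] lt by simp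
  define c where "c j = (if j < J then \<theta> * b j else b j powr p)" for j
  define g where "g j = (if j < J then \<theta> powr (- p / (1 - p)) else b j powr p)" for j
  have c0: "c j > 0" and g0: "g j > 0" for j using b[of j] \<theta> by (auto simp: c_def g_def)
  have sc: "summable c"
    by (subst summable_cong[OF eventually_mono[OF eventually_ge_at_top[of J]]])
      (use sp in \<open>auto simp: c_def\<close>)
  have sg: "summable g"
    by (subst summable_cong[OF eventually_mono[OF eventually_ge_at_top[of J]]])
      (use sp in \<open>auto simp: g_def\<close>)
  have g1: "g j < 1" for j
  proof (cases "j < J")
    case True
    have "\<theta> powr (- p / (1 - p)) < \<theta> powr 0"
      using \<theta> p p1 by (intro powr_less_mono) (auto simp: divide_simps)
    thus ?thesis using True \<theta> by (simp add: g_def)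
  next
    case False
    have "b j powr p < 1 powr p" using b[of j] b1[of j] p by (intro powr_less_mono2) auto
    thus ?thesis using False by (simp add: g_def)
  qed
  have "suminf c = (\<Sum>j. c (j + J)) + (\<Sum>j<J. c j)" by (rule suminf_split_initial_segment[OF sc])
  also have "(\<Sum>j. c (j + J)) = (\<Sum>j. b (j + J) powr p)" by (simp add: c_def)
  also have "(\<Sum>j<J. c j) = \<theta> * (\<Sum>j<J. b j)" by (simp add: c_def sum_distrib_left)
  also have "\<theta> * (\<Sum>j<J. b j) \<le> \<theta> * A"
    unfolding A_def using \<theta> less_imp_le[OF b] by (intro mult_left_mono sum_le_suminf sb) auto
  finally have c1: "suminf c < 1" using J \<theta>(2) by (simp add: field_simps)
  have eq: "b j powr p = c j powr p * g j powr (1 - p)" for j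
  proof (cases "j < J")
    case True
    have "(\<theta> powr (- p / (1 - p))) powr (1 - p) = \<theta> powr (- p)"
      using p1 by (simp add: powr_powr)
    thus ?thesis using True \<theta> b[of j]
      by (simp add: c_def g_def powr_mult powr_minus)
  next
    case False
    thus ?thesis by (simp add: c_def g_def powr_powr algebra_simps flip: powr_add)
  qed
  show ?thesis
  proof (rule summable_on_comparison_test)
    show "(\<lambda>s. p * multinom c s + (1 - p) * mi_pow g s) summable_on FS"
      by (intro summable_on_add summable_on_cmult_right multinom_summable mi_pow_summable)
        (use c0 g0 sc sg c1 g1 in \<open>auto intro: less_imp_le\<close>)
    fix s assume "s \<in> FS"
    show "multinom b s powr p \<le> p * multinom c s + (1 - p) * mi_pow g s"
      unfolding multinom_powr_interpolate[OF b c0 g0 eq]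
      using p p1 by (intro Youngs_inequality_0 multinom_pos mi_pow_pos c0 g0) auto
  qed auto
qed

section \<open>Orthonormality in one variable\<close>

text \<open>The name \<open>coeff\<close> is taken by the expansion coefficients.\<close>

abbreviation pcoeff :: "'a::zero poly \<Rightarrow> nat \<Rightarrow> 'a" where "pcoeff \<equiv> Polynomial.coeff"

lemma prob_space_uniform_Icc: "a < b \<Longrightarrow> prob_space (uniform_measure lborel {a..b::real})"
  by (intro prob_space_uniform_measure) auto

lemma uniform_Icc_FTC:
  fixes f :: "real \<Rightarrow> 'a :: euclidean_space"
  assumes ab: "a < b" and F: "\<And>x. (F has_vector_derivative f x) (at x)"
    and f: "continuous_on UNIV f"
  shows "integrable (uniform_measure lborel {a..b}) f"
    and "(LINT x|uniform_measure lborel {a..b}. f x) = (F b - F a) /\<^sub>R (b - a)"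
proof -
  have meas: "f \<in> borel_measurable lborel"
    using borel_measurable_continuous_onI[OF f] by simp
  have U: "uniform_measure lborel {a..b} = density lborel (\<lambda>x. ennreal (indicator {a..b} x / (b - a)))"
    unfolding uniform_measure_def using ab divide_ennreal[of 1 "b - a"]
    by (intro density_cong) (auto split: split_indicator)
  have eq: "(indicator {a..b} x / (b - a)) *\<^sub>R f x = (1 / (b - a)) *\<^sub>R (indicator {a..b} x *\<^sub>R f x)" for x
    by simp
  have "has_bochner_integral lborel (\<lambda>x. indicator {a..b} x *\<^sub>R f x) (F b - F a)"
    using ab F f by (intro has_bochner_integral_FTC_Icc)
      (auto intro: has_vector_derivative_at_within continuous_on_subset)
  hence has: "has_bochner_integral lborel (\<lambda>x. (indicator {a..b} x / (b - a)) *\<^sub>R f x)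
      ((1 / (b - a)) *\<^sub>R (F b - F a))"
    unfolding eq by (rule has_bochner_integral_scaleR_right)
  show "integrable (uniform_measure lborel {a..b}) f"
    unfolding U using has ab meas by (subst integrable_density) (auto simp: has_bochner_integral_iff)
  show "(LINT x|uniform_measure lborel {a..b}. f x) = (F b - F a) /\<^sub>R (b - a)"
    unfolding U using has ab meas
    by (subst integral_density) (auto simp: has_bochner_integral_iff inverse_eq_divide)
qed

lemma uniform_Ico_eq_Icc: "a < b \<Longrightarrow> uniform_measure lborel {a..<b::real} = uniform_measure lborel {a..b}"
  unfolding uniform_measure_def
proof (rule density_cong)
  assume "a < b"
  have "AE x in lborel. x \<noteq> b" by (rule AE_lborel_singleton)
  thus "AE x in lborel. indicator {a..<b} x / emeasure lborel {a..<b} = indicator {a..b} x / emeasure lborel {a..b}"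
    by eventually_elim (use \<open>a < b\<close> in \<open>auto split: split_indicator\<close>)
qed auto

definition char1 :: "int \<Rightarrow> real \<Rightarrow> complex"
  where "char1 n x = exp (2 * of_real pi * \<i> * of_int n * of_real x)"

lemma char1_mult_cnj: "char1 n x * cnj (char1 l x) = char1 (n - l) x"
  unfolding char1_def by (simp add: exp_cnj exp_add[symmetric] algebra_simps)

lemma continuous_char1: "continuous_on A (char1 n)"
  unfolding char1_def by (intro continuous_intros)

lemma char1_integral:
  shows "integrable (uniform_measure lborel {0..<1}) (char1 n)"
    and "(LINT x|uniform_measure lborel {0..<1}. char1 n x) = (if n = 0 then 1 else 0)"
proof -
  define F where "F x = (if n = 0 then of_real x else char1 n x / (2 * of_real pi * \<i> * of_int n))" for x
  have "(F has_vector_derivative char1 n x) (at x)" for x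
  proof (cases "n = 0")
    case True
    have "((\<lambda>x. of_real x :: complex) has_vector_derivative 1) (at x)"
      by (auto intro!: derivative_eq_intros)
    thus ?thesis using True by (simp add: F_def[abs_def] char1_def)
  next
    case False
    have "((\<lambda>z. exp (2 * of_real pi * \<i> * of_int n * z) / (2 * of_real pi * \<i> * of_int n))
        has_field_derivative exp (2 * of_real pi * \<i> * of_int n * of_real x)) (at (of_real x))"
      using False by (auto intro!: derivative_eq_intros)
    from has_vector_derivative_real_field[OF this] show ?thesis
      using False by (simp add: F_def[abs_def] char1_def)
  qed
  note FTC = uniform_Icc_FTC[of 0 1 F "char1 n", OF _ this continuous_char1]
  show "integrable (uniform_measure lborel {0..<1}) (char1 n)"
    using FTC(1) by (simp add: uniform_Ico_eq_Icc)
  have "exp (2 * of_real pi * \<i> * of_int n) = (1 :: complex)"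
    using exp_integer_2pi[of "of_int n"] by (simp add: mult_ac)
  hence "F 1 - F 0 = (if n = 0 then 1 else 0)" by (simp add: F_def char1_def)
  thus "(LINT x|uniform_measure lborel {0..<1}. char1 n x) = (if n = 0 then 1 else 0)"
    using FTC(2) by (simp add: uniform_Ico_eq_Icc)
qed

definition poly_mean :: "real poly \<Rightarrow> real"
  where "poly_mean p = (LINT x|uniform_measure lborel {-1..1}. poly p x)"

text \<open>
  A polynomial antiderivative, to which the fundamental theorem of calculus applies.
\<close>

lemma exists_pderiv: "\<exists>q. pderiv q = (p :: 'a :: field_char_0 poly)"
proof
  define c where "c k = pcoeff p (k - 1) / of_nat k" for k
  define q where "q = (\<Sum>k\<le>Suc (degree p). monom (c k) k)"
  have "pcoeff (pderiv q) k = pcoeff p k" for k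
  proof -
    have "pcoeff q (Suc k) = (if Suc k \<le> Suc (degree p) then c (Suc k) else 0)"
      by (simp add: q_def coeff_sum)
    thus ?thesis by (simp add: coeff_pderiv c_def coeff_eq_0 del: of_nat_Suc)
  qed
  thus "pderiv q = p" by (intro poly_eqI)
qed

lemma integrable_poly: "integrable (uniform_measure lborel {-1..1}) (poly (p :: real poly))"
  and poly_mean_pderiv: "poly_mean (pderiv q) = (poly q 1 - poly q (-1)) / 2"
proof -
  have d: "(poly q has_vector_derivative poly (pderiv q) x) (at x)" for q :: "real poly" and x
    using poly_DERIV[of q x] by (simp add: has_real_derivative_iff_has_vector_derivative)
  have c: "continuous_on UNIV (poly q)" for q :: "real poly"
    using continuous_on_poly[OF continuous_on_id, of UNIV q] by (simp add: id_def)
  note FTC = uniform_Icc_FTC[of "-1" 1, OF _ d c]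
  obtain q' where "pderiv q' = p" using exists_pderiv by blast
  thus "integrable (uniform_measure lborel {-1..1}) (poly p)"
    using FTC(1)[of q'] by auto
  show "poly_mean (pderiv q) = (poly q 1 - poly q (-1)) / 2"
    unfolding poly_mean_def using FTC(2)[of q] by simp
qed

lemma poly_mean_add: "poly_mean (p + q) = poly_mean p + poly_mean q"
  using Bochner_Integration.integral_add[OF integrable_poly integrable_poly, of p q]
  by (simp add: poly_mean_def flip: poly_add)

lemma poly_mean_smult: "poly_mean (smult c p) = c * poly_mean p"
  by (simp add: poly_mean_def flip: poly_smult integral_mult_right_zero)

lemma poly_mean_by_parts:
  assumes "poly q 1 = 0" "poly q (-1) = 0"
  shows "poly_mean (p * pderiv q) = - poly_mean (pderiv p * q)"
  using poly_mean_pderiv[of "p * q"] assms poly_mean_add[of "p * pderiv q" "q * pderiv p"]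
  by (simp add: pderiv_mult mult.commute)

abbreviation rodrigues_base :: "real poly"
  where "rodrigues_base \<equiv> [:-1, 0, 1:]"

text \<open>
  Each derivative costs at most one factor \<open>w\<close>.
\<close>

lemma higher_pderiv_divisible:
  fixes w :: "'a :: {comm_ring_1,semiring_no_zero_divisors} poly"
  assumes "k \<le> n"
  shows "w ^ (n - k) dvd (pderiv ^^ k) (w ^ n)"
  using assms
proof (induction k)
  case (Suc k)
  then obtain r where r: "(pderiv ^^ k) (w ^ n) = w ^ Suc (n - Suc k) * r"
    by (auto simp: dvd_def Suc_diff_Suc)
  have "pderiv (w ^ Suc l * r) = w ^ l * (w * pderiv r + of_nat (Suc l) * pderiv w * r)" for l
    unfolding pderiv_mult pderiv_power_Suc by (simp add: algebra_simps of_nat_poly)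
  thus ?case by (simp add: r)
qed auto

lemma rodrigues_boundary:
  assumes "k < n" "x = 1 \<or> x = -1"
  shows "poly ((pderiv ^^ k) (rodrigues_base ^ n)) x = 0"
proof -
  have "rodrigues_base ^ (n - k) dvd (pderiv ^^ k) (rodrigues_base ^ n)"
    using assms by (intro higher_pderiv_divisible) auto
  moreover have "poly (rodrigues_base ^ (n - k)) x = 0" using assms by (auto simp: poly_power)
  ultimately show ?thesis by (metis dvdE mult_zero_left poly_mult)
qed

text \<open>
  In each integration by parts the boundary terms vanish, since \<open>(x\<^sup>2 - 1)\<^sup>n\<close> has zeros of order \<open>n\<close> at
  the end points.
\<close>

lemma rodrigues_by_parts:
  assumes "k \<le> n"
  shows "poly_mean (p * (pderiv ^^ n) (rodrigues_base ^ n))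
         = (- 1) ^ k * poly_mean ((pderiv ^^ k) p * (pderiv ^^ (n - k)) (rodrigues_base ^ n))"
  using assms
proof (induction k)
  case (Suc k)
  let ?q = "(pderiv ^^ (n - Suc k)) (rodrigues_base ^ n)"
  have eq: "(pderiv ^^ (n - k)) (rodrigues_base ^ n) = pderiv ?q"
    using Suc.prems by (metis Suc_diff_Suc Suc_le_lessD comp_apply funpow.simps(2))
  have "poly_mean ((pderiv ^^ k) p * pderiv ?q) = - poly_mean (pderiv ((pderiv ^^ k) p) * ?q)"
    by (rule poly_mean_by_parts) (use Suc.prems in \<open>auto intro!: rodrigues_boundary\<close>)
  thus ?case using Suc eq by simp
qed simp

lemma higher_pderiv_const:
  fixes p :: "'a :: {comm_semiring_1,semiring_no_zero_divisors,semiring_char_0} poly"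
  assumes "degree p \<le> n"
  shows "(pderiv ^^ n) p = [:fact n * pcoeff p n:]"
  using assms
proof (induction n arbitrary: p)
  case 0
  thus ?case by (simp add: degree_eq_zeroE) (metis coeff_pCons_0 degree_eq_zeroE)
next
  case (Suc n)
  have "(pderiv ^^ Suc n) p = (pderiv ^^ n) (pderiv p)" by (simp add: funpow_Suc_right del: funpow.simps)
  also have "\<dots> = [:fact n * pcoeff (pderiv p) n:]"
    using Suc.prems by (intro Suc.IH) (simp add: degree_pderiv)
  finally show ?case by (simp add: coeff_pderiv algebra_simps)
qed

text \<open>
  With \<open>w = x\<^sup>2 - 1\<close>, the derivative of \<open>x w^(n+1)\<close> is a combination of \<open>w^(n+1)\<close> and \<open>w\<^sup>n\<close> and has mean zero.
  This gives the recurrence for the means.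
\<close>

lemma poly_mean_rodrigues_base_power:
  "poly_mean (rodrigues_base ^ n) = (- 1) ^ n * 4 ^ n * (fact n)\<^sup>2 / fact (2 * n + 1)"
proof (induction n)
  case 0
  have "prob_space (uniform_measure lborel {-1..1::real})" by (rule prob_space_uniform_Icc) simp
  then interpret prob_space "uniform_measure lborel {-1..1::real}" .
  show ?case using prob_space by (simp add: poly_mean_def)
next
  case (Suc n)
  let ?w = rodrigues_base
  have collect: "w * W + smult r (smult 2 w + [:2:]) * W = smult (2 * r + 1) (w * W) + smult (2 * r) W"
    for w W :: "real poly" and r
    by (simp add: algebra_simps smult_add_left smult_add_right)
  have "pderiv ([:0, 1:] * ?w ^ Suc n) = smult (2 * real n + 3) (?w ^ Suc n) + smult (2 * real n + 2) (?w ^ n)"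
  proof -
    have "pderiv ([:0, 1:] * ?w ^ Suc n) = ?w ^ Suc n + smult (real (Suc n)) ([:0, 1:] * pderiv ?w) * ?w ^ n"
      unfolding pderiv_mult pderiv_power_Suc by (simp add: pderiv_pCons algebra_simps)
    also have "[:0, 1:] * pderiv ?w = smult 2 ?w + [:2:]" by (simp add: pderiv_pCons)
    also have "?w ^ Suc n + smult (real (Suc n)) (smult 2 ?w + [:2:]) * ?w ^ n
        = smult (2 * real n + 3) (?w ^ Suc n) + smult (2 * real n + 2) (?w ^ n)"
      using collect[of ?w "?w ^ n" "real (Suc n)"] by (simp add: algebra_simps)
    finally show ?thesis .
  qed
  hence "(2 * real n + 3) * poly_mean (?w ^ Suc n) + (2 * real n + 2) * poly_mean (?w ^ n) = 0"
    using poly_mean_pderiv[of "[:0, 1:] * ?w ^ Suc n"]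
    by (simp only: poly_mean_add poly_mean_smult) simp
  hence "poly_mean (?w ^ Suc n) = - (2 * real n + 2) / (2 * real n + 3) * poly_mean (?w ^ n)"
    by (simp add: field_simps)
  moreover have "fact (2 * Suc n + 1) = (2 * real n + 3) * (2 * real n + 2) * fact (2 * n + 1)"
    by (simp add: algebra_simps)
  moreover have "fact (Suc n) = (2 * real n + 2) / 2 * fact n" by (simp add: algebra_simps)
  moreover have "- u / v * (S * E * f\<^sup>2 / F) = (- 1 * S) * (4 * E) * (u / 2 * f)\<^sup>2 / (v * u * F)"
    if "u > 0" "v > 0" "F > 0" for u v F S E f :: real
    using that by (simp add: field_simps power2_eq_square)
  from this[of "2 * real n + 2" "2 * real n + 3" "fact (2 * n + 1)" "(- 1) ^ n" "4 ^ n" "fact n"]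
  have "- (2 * real n + 2) / (2 * real n + 3) * ((- 1) ^ n * 4 ^ n * (fact n)\<^sup>2 / fact (2 * n + 1))
    = (- 1 * (- 1) ^ n) * (4 * 4 ^ n) * ((2 * real n + 2) / 2 * fact n)\<^sup>2
       / ((2 * real n + 3) * (2 * real n + 2) * fact (2 * n + 1))"
    using fact_gt_zero[of "2 * n + 1", where 'a = real] by linarith
  ultimately show ?case unfolding Suc.IH by (simp only: power_Suc)
qed

lemma degree_rodrigues: "degree (rodrigues_base ^ n) = 2 * n" "pcoeff (rodrigues_base ^ n) (2 * n) = 1"
proof -
  show d: "degree (rodrigues_base ^ n) = 2 * n" by (simp add: degree_power_eq)
  show "pcoeff (rodrigues_base ^ n) (2 * n) = 1"
    using lead_coeff_power[of rodrigues_base n] d by simp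
qed

lemma degree_funpow_pderiv:
  fixes p :: "real poly"
  shows "degree ((pderiv ^^ n) p) = degree p - n"
  by (induction n) (auto simp: degree_pderiv)

lemma degree_legendre: "degree (legendre n) = n"
proof -
  have "fact n \<noteq> (0::real)" "2 * real n + 1 > 0" by auto
  thus ?thesis by (simp add: legendre_def degree_funpow_pderiv degree_rodrigues)
qed

lemma legendre_0: "legendre 0 = 1"
  by (simp add: legendre_def)

text \<open>
  Integration by parts moves all \<open>n\<close> derivatives of Rodrigues' formula to the other factor. If that
  factor has degree at most \<open>n\<close>, only a constant is left, namely its coefficient of \<open>x\<^sup>n\<close> times \<open>n!\<close>.
\<close>

lemma legendre_orthonormal:
  "poly_mean (legendre i * legendre n) = (if i = n then 1 else 0)"
proof -
  define c where "c n = sqrt (2 * real n + 1) / (2 ^ n * fact n)" for n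
  have leg: "legendre n = smult (c n) ((pderiv ^^ n) (rodrigues_base ^ n))" for n
    by (simp add: legendre_def c_def)
  have le: "poly_mean (p * legendre n)
      = c n * (- 1) ^ n * (fact n * pcoeff p n) * poly_mean (rodrigues_base ^ n)"
    if "degree p \<le> n" for p n
  proof -
    have "poly_mean (p * legendre n) = c n * poly_mean (p * (pderiv ^^ n) (rodrigues_base ^ n))"
      unfolding leg by (simp add: poly_mean_smult)
    also have "\<dots> = c n * ((- 1) ^ n * poly_mean ((pderiv ^^ n) p * rodrigues_base ^ n))"
      using rodrigues_by_parts[of n n p] by simp
    also have "\<dots> = c n * ((- 1) ^ n * poly_mean (smult (fact n * pcoeff p n) (rodrigues_base ^ n)))"
      using that by (simp add: higher_pderiv_const)
    finally show ?thesis by (simp add: poly_mean_smult)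
  qed
  have less: "poly_mean (legendre i * legendre n) = 0" if "i < n" for i n
    using le[of "legendre i" n] that by (simp add: degree_legendre coeff_eq_0)
  show ?thesis
  proof (cases i n rule: linorder_cases)
    case equal
    have "fact n * pcoeff (legendre n) n = c n * fact (2 * n)"
    proof -
      have "[:fact n * pcoeff (legendre n) n:] = (pderiv ^^ n) (legendre n)"
        by (rule higher_pderiv_const[symmetric]) (simp add: degree_legendre)
      also have "\<dots> = smult (c n) ((pderiv ^^ (2 * n)) (rodrigues_base ^ n))"
      proof -
        have "(pderiv ^^ k) (smult a p) = smult a ((pderiv ^^ k) p)" for k a and p :: "real poly"
          by (induction k) (auto simp: pderiv_smult)
        thus ?thesis unfolding leg by (simp add: mult_2 funpow_add)
      qed
      also have "\<dots> = [:c n * fact (2 * n):]"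
        by (subst higher_pderiv_const) (auto simp: degree_rodrigues)
      finally show ?thesis by simp
    qed
    hence "poly_mean (legendre n * legendre n) = (c n)\<^sup>2 * (4 ^ n * (fact n)\<^sup>2 / (2 * real n + 1))"
    proof -
      have "poly_mean (legendre n * legendre n)
          = c n * (- 1) ^ n * (c n * fact (2 * n)) * ((- 1) ^ n * 4 ^ n * (fact n)\<^sup>2 / fact (2 * n + 1))"
        using le[of "legendre n" n] \<open>_ = c n * fact (2 * n)\<close>
        by (simp only: degree_legendre poly_mean_rodrigues_base_power order_refl)
      also have "\<dots> = ((- 1) ^ n * (- 1) ^ n) * ((c n)\<^sup>2 * (4 ^ n * (fact n)\<^sup>2 * (fact (2 * n) / fact (2 * n + 1))))"
        by (simp only: power2_eq_square times_divide_eq_right mult_ac)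
      also have "(- 1) ^ n * (- 1) ^ n = (1::real)" by (simp flip: power_add)
      also have "fact (2 * n) / fact (2 * n + 1) = 1 / (2 * real n + 1)"
      proof -
        have "fact (2 * n + 1) = (2 * real n + 1) * fact (2 * n)" by (simp add: algebra_simps)
        thus ?thesis by (simp only:) simp
      qed
      finally show ?thesis by simp
    qed
    also have "(c n)\<^sup>2 = (2 * real n + 1) / (4 ^ n * (fact n)\<^sup>2)"
    proof -
      have "((2::real) ^ n)\<^sup>2 = 4 ^ n" by (simp add: power2_eq_square flip: power_mult_distrib)
      thus ?thesis by (simp add: c_def power_divide power_mult_distrib)
    qed
    also have "\<dots> * (4 ^ n * (fact n)\<^sup>2 / (2 * real n + 1)) = 1"
    proof -
      have "x / y * (y / x) = 1" if "x > 0" "y > 0" for x y :: real using that by simp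
      from this[of "2 * real n + 1" "4 ^ n * (fact n)\<^sup>2"] show ?thesis by simp
    qed
    finally show ?thesis using equal by simp
  next
    case greater
    thus ?thesis using less[of n i] by (simp add: mult.commute)
  qed (use less in auto)
qed

section \<open>The orthonormal system on the torus times the cube\<close>

interpretation torus1: prob_space "uniform_measure lborel {0..<1::real}"
  using prob_space_uniform_Icc[of 0 1] by (simp add: uniform_Ico_eq_Icc)

interpretation interval1: prob_space "uniform_measure lborel {-1..1::real}"
  by (rule prob_space_uniform_Icc) simp

interpretation torus: product_prob_space "\<lambda>_. uniform_measure lborel {0..<1::real}" "{..<m}" for m :: nat
  by unfold_locales

interpretation cube: product_prob_space "\<lambda>_. uniform_measure lborel {-1..1::real}" J for J :: "nat set"
  by unfold_locales

interpretation cube_UNIV: sequence_space "uniform_measure lborel {-1..1::real}"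
  by unfold_locales

interpretation torus_m: prob_space "torus m" for m
  unfolding torus_def by (rule torus.P.prob_space_axioms)

interpretation cube_J: prob_space "cube J" for J
  unfolding cube_def by (rule cube.P.prob_space_axioms)

interpretation torus_cube: pair_prob_space "torus m" "cube J" for m J
  by unfold_locales

lemma borel_measurable_coordinate_cube [measurable]: "j \<in> J \<Longrightarrow> (\<lambda>y. y j) \<in> borel_measurable (cube J)"
proof -
  assume "j \<in> J"
  hence "(\<lambda>y. y j) \<in> measurable (cube J) (uniform_measure lborel {-1..1})"
    unfolding cube_def by (rule measurable_component_singleton)
  thus ?thesis
    using measurable_cong_sets[of "cube J" "cube J" "uniform_measure lborel {-1..1::real}" borel] by simp
qed

lemma borel_measurable_coordinate_torus [measurable]: "j < m \<Longrightarrow> (\<lambda>y. y j) \<in> borel_measurable (torus m)"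
proof -
  assume "j < m"
  hence "(\<lambda>y. y j) \<in> measurable (torus m) (uniform_measure lborel {0..<1})"
    unfolding torus_def by (intro measurable_component_singleton) simp
  thus ?thesis
    using measurable_cong_sets[of "torus m" "torus m" "uniform_measure lborel {0..<1::real}" borel] by simp
qed

lemma borel_measurable_poly [measurable]: "poly (p :: real poly) \<in> borel_measurable borel"
  using continuous_on_poly[OF continuous_on_id, of UNIV p]
  by (intro borel_measurable_continuous_onI) (simp add: id_def)

lemma borel_measurable_char1 [measurable]: "char1 n \<in> borel_measurable borel"
  by (intro borel_measurable_continuous_onI continuous_char1)

lemma trig_eq: "trig m k x = (\<Prod>j<m. char1 (k j) (x j))"
  by (simp add: trig_def char1_def)

lemma borel_measurable_trig [measurable]: "trig m k \<in> borel_measurable (torus m)"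
  unfolding trig_eq[abs_def] by measurable

lemma trig_orthonormal:
  assumes "k \<in> Zstar m" "l \<in> Zstar m"
  shows "integrable (torus m) (\<lambda>x. trig m k x * cnj (trig m l x))"
    and "(LINT x|torus m. trig m k x * cnj (trig m l x)) = (if k = l then 1 else 0)"
proof -
  have eq: "trig m k x * cnj (trig m l x) = (\<Prod>j<m. char1 (k j - l j) (x j))" for x
    by (simp add: trig_eq char1_mult_cnj flip: prod.distrib)
  show "integrable (torus m) (\<lambda>x. trig m k x * cnj (trig m l x))"
    unfolding eq torus_def by (intro torus.product_integrable_prod char1_integral(1)) auto
  have "(LINT x|torus m. trig m k x * cnj (trig m l x)) = (\<Prod>j<m. if k j - l j = 0 then 1 else 0)"
    unfolding eq torus_def
    by (subst torus.product_integral_prod) (auto simp: char1_integral intro!: prod.cong)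
  also have "\<dots> = (if \<forall>j<m. k j = l j then 1 else 0)" by (auto intro!: prod.neutral)
  also have "(\<forall>j<m. k j = l j) \<longleftrightarrow> k = l"
    using assms PiE_ext[of k "{..<m}" _ l] by (auto simp: Zstar_def)
  finally show "(LINT x|torus m. trig m k x * cnj (trig m l x)) = (if k = l then 1 else 0)" .
qed

text \<open>
  The integrand depends on finitely many coordinates, so the integral is one over the push-forward to
  these, where the finite product formula applies.
\<close>

lemma cube_product_integral:
  fixes P :: "nat \<Rightarrow> real poly"
  assumes D: "finite D" "D \<subseteq> J"
  shows "integrable (cube J) (\<lambda>y. \<Prod>j\<in>D. poly (P j) (y j))"
    and "(LINT y|cube J. (\<Prod>j\<in>D. poly (P j) (y j))) = (\<Prod>j\<in>D. poly_mean (P j))"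
proof -
  have distr: "distr (cube J) (cube D) (\<lambda>y. restrict y D) = cube D"
    unfolding cube_def by (rule cube.distr_PiM_restrict_finite[OF D])
  have m1 [measurable]: "(\<lambda>y. restrict y D) \<in> measurable (cube J) (cube D)"
    unfolding cube_def using D by (intro measurable_restrict_subset)
  have m2: "(\<lambda>y. \<Prod>j\<in>D. poly (P j) (y j)) \<in> borel_measurable (cube D)" by measurable
  have i: "integrable (cube D) (\<lambda>y. \<Prod>j\<in>D. poly (P j) (y j))"
    unfolding cube_def by (intro cube.product_integrable_prod D integrable_poly)
  have r: "(\<Prod>j\<in>D. poly (P j) (restrict y D j)) = (\<Prod>j\<in>D. poly (P j) (y j))" for y :: "nat \<Rightarrow> real"
    by simp
  show "integrable (cube J) (\<lambda>y. \<Prod>j\<in>D. poly (P j) (y j))"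
    using i integrable_distr_eq[OF m1 m2] unfolding distr r by simp
  have "(LINT y|cube J. (\<Prod>j\<in>D. poly (P j) (y j))) = (LINT y|cube D. (\<Prod>j\<in>D. poly (P j) (y j)))"
    using integral_distr[OF m1 m2] unfolding distr r by simp
  also have "\<dots> = (\<Prod>j\<in>D. poly_mean (P j))"
    unfolding cube_def poly_mean_def by (intro cube.product_integral_prod D integrable_poly)
  finally show "(LINT y|cube J. (\<Prod>j\<in>D. poly (P j) (y j))) = (\<Prod>j\<in>D. poly_mean (P j))" .
qed

lemma legendre_prod_eq: "finite D \<Longrightarrow> supp t \<subseteq> D \<Longrightarrow> legendre_prod t y = (\<Prod>j\<in>D. poly (legendre (t j)) (y j))"
  unfolding legendre_prod_def by (rule prod.mono_neutral_left) (auto simp: supp_def legendre_0)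

lemma borel_measurable_legendre_prod [measurable]:
  "supp t \<subseteq> J \<Longrightarrow> legendre_prod t \<in> borel_measurable (cube J)"
  unfolding legendre_prod_def[abs_def] by (measurable, auto)

lemma legendre_prod_orthonormal:
  assumes "t \<in> FS" "u \<in> FS" "supp t \<subseteq> J" "supp u \<subseteq> J"
  shows "integrable (cube J) (\<lambda>y. legendre_prod t y * legendre_prod u y)"
    and "(LINT y|cube J. legendre_prod t y * legendre_prod u y) = (if t = u then 1 else 0)"
proof -
  define D where "D = supp t \<union> supp u"
  have D: "finite D" "D \<subseteq> J" "supp t \<subseteq> D" "supp u \<subseteq> D" using assms by (auto simp: D_def FS_def)
  have eq: "legendre_prod t y * legendre_prod u y = (\<Prod>j\<in>D. poly (legendre (t j) * legendre (u j)) (y j))" for y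
    unfolding legendre_prod_eq[OF D(1,3)] legendre_prod_eq[OF D(1,4)] by (simp add: prod.distrib)
  show "integrable (cube J) (\<lambda>y. legendre_prod t y * legendre_prod u y)"
    unfolding eq by (rule cube_product_integral(1)[OF D(1,2)])
  have "(LINT y|cube J. legendre_prod t y * legendre_prod u y) = (\<Prod>j\<in>D. if t j = u j then 1 else 0)"
    unfolding eq cube_product_integral(2)[OF D(1,2)] legendre_orthonormal ..
  also have "\<dots> = (if \<forall>j\<in>D. t j = u j then 1 else 0)" using D(1) by (auto intro!: prod.neutral)
  also have "(\<forall>j\<in>D. t j = u j) \<longleftrightarrow> t = u"
  proof
    assume eq: "\<forall>j\<in>D. t j = u j"
    show "t = u"
    proof
      fix j show "t j = u j"
      proof (cases "j \<in> D")
        case False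
        hence "t j = 0" "u j = 0" by (simp_all add: D_def supp_def)
        thus ?thesis by simp
      qed (use eq in blast)
    qed
  qed simp
  finally show "(LINT y|cube J. legendre_prod t y * legendre_prod u y) = (if t = u then 1 else 0)" .
qed

lemma (in pair_sigma_finite) integrable_product_functions:
  fixes f :: "'a \<Rightarrow> complex" and g :: "'b \<Rightarrow> complex"
  assumes f: "integrable M1 f" and g: "integrable M2 g"
  shows "integrable (M1 \<Otimes>\<^sub>M M2) (\<lambda>(x, y). f x * g y)"
    and "(LINT z|(M1 \<Otimes>\<^sub>M M2). (case z of (x, y) \<Rightarrow> f x * g y)) = (LINT x|M1. f x) * (LINT y|M2. g y)"
proof -
  have [measurable]: "f \<in> borel_measurable M1" "g \<in> borel_measurable M2" using f g by auto
  show int: "integrable (M1 \<Otimes>\<^sub>M M2) (\<lambda>(x, y). f x * g y)"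
    using f g by (intro Fubini_integrable) (auto simp: norm_mult)
  show "(LINT z|(M1 \<Otimes>\<^sub>M M2). (case z of (x, y) \<Rightarrow> f x * g y)) = (LINT x|M1. f x) * (LINT y|M2. g y)"
    by (subst integral_fst'[OF int, symmetric]) simp
qed

lemma borel_measurable_basis_fun [measurable]:
  assumes "supp t \<subseteq> J"
  shows "basis_fun m (k, t) \<in> borel_measurable (torus m \<Otimes>\<^sub>M cube J)"
proof -
  have "legendre_prod t \<in> borel_measurable (cube J)" using assms by measurable
  hence "(\<lambda>(x, y). trig m k x * complex_of_real (legendre_prod t y)) \<in> borel_measurable (torus m \<Otimes>\<^sub>M cube J)"
    by measurable
  thus ?thesis by (simp add: basis_fun_def)
qed

lemma basis_fun_orthonormal:
  assumes "(k, t) \<in> Zstar m \<times> FS" "(l, u) \<in> Zstar m \<times> FS" "supp t \<subseteq> J" "supp u \<subseteq> J"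
  shows "integrable (torus m \<Otimes>\<^sub>M cube J) (\<lambda>z. basis_fun m (k, t) z * cnj (basis_fun m (l, u) z))"
    and "(LINT z|(torus m \<Otimes>\<^sub>M cube J). basis_fun m (k, t) z * cnj (basis_fun m (l, u) z))
         = (if (k, t) = (l, u) then 1 else 0)"
proof -
  let ?f = "\<lambda>x. trig m k x * cnj (trig m l x)" and ?g = "\<lambda>y. legendre_prod t y * legendre_prod u y"
  have eq: "(\<lambda>z. basis_fun m (k, t) z * cnj (basis_fun m (l, u) z)) = (\<lambda>(x, y). ?f x * of_real (?g y))"
    by (auto simp: basis_fun_def fun_eq_iff)
  have f: "integrable (torus m) ?f" "(LINT x|torus m. ?f x) = (if k = l then 1 else 0)"
    using trig_orthonormal assms by auto
  have g: "integrable (cube J) ?g" "(LINT y|cube J. ?g y) = (if t = u then 1 else 0)"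
    using legendre_prod_orthonormal assms by auto
  have g': "integrable (cube J) (\<lambda>y. complex_of_real (?g y))" using g(1) by (rule integrable_of_real)
  have g'': "(LINT y|cube J. complex_of_real (?g y)) = of_real (if t = u then 1 else 0)"
    unfolding g(2)[symmetric] by (rule integral_complex_of_real)
  show "integrable (torus m \<Otimes>\<^sub>M cube J) (\<lambda>z. basis_fun m (k, t) z * cnj (basis_fun m (l, u) z))"
    unfolding eq by (rule torus_cube.integrable_product_functions(1)[OF f(1) g'])
  show "(LINT z|(torus m \<Otimes>\<^sub>M cube J). basis_fun m (k, t) z * cnj (basis_fun m (l, u) z))
         = (if (k, t) = (l, u) then 1 else 0)"
    unfolding eq using torus_cube.integrable_product_functions(2)[OF f(1) g'] f(2) g'' by simp
qed

lemma basis_fun_L2: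
  assumes "(k, t) \<in> Zstar m \<times> FS" "supp t \<subseteq> J"
  shows "basis_fun m (k, t) \<in> L2 (torus m \<Otimes>\<^sub>M cube J)"
proof -
  have "integrable (torus m \<Otimes>\<^sub>M cube J) (\<lambda>z. basis_fun m (k, t) z * cnj (basis_fun m (k, t) z))"
    by (rule basis_fun_orthonormal(1)) (use assms in auto)
  hence "integrable (torus m \<Otimes>\<^sub>M cube J) (\<lambda>z. complex_of_real ((cmod (basis_fun m (k, t) z))\<^sup>2))"
    unfolding complex_norm_square .
  from integrable_Re[OF this]
  have "integrable (torus m \<Otimes>\<^sub>M cube J) (\<lambda>z. (cmod (basis_fun m (k, t) z))\<^sup>2)" by simp
  thus ?thesis using assms by (simp add: L2_def)
qed

lemma L2_add:
  assumes "v \<in> L2 M" "w \<in> L2 M"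
  shows "(\<lambda>z. v z + w z) \<in> L2 M"
proof -
  have [measurable]: "v \<in> borel_measurable M" "w \<in> borel_measurable M" using assms by (auto simp: L2_def)
  have "(cmod (v z + w z))\<^sup>2 \<le> 2 * (cmod (v z))\<^sup>2 + 2 * (cmod (w z))\<^sup>2" for z
  proof -
    have "(cmod (v z + w z))\<^sup>2 \<le> (cmod (v z) + cmod (w z))\<^sup>2"
      by (intro power_mono norm_triangle_ineq) simp
    also have "\<dots> \<le> 2 * (cmod (v z))\<^sup>2 + 2 * (cmod (w z))\<^sup>2"
      using sum_squares_bound[of "cmod (v z)" "cmod (w z)"] by (simp add: power2_sum)
    finally show ?thesis .
  qed
  hence le: "norm ((cmod (v z + w z))\<^sup>2) \<le> norm (2 * (cmod (v z))\<^sup>2 + 2 * (cmod (w z))\<^sup>2)" for z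
    by simp
  have "integrable M (\<lambda>z. 2 * (cmod (v z))\<^sup>2 + 2 * (cmod (w z))\<^sup>2)"
    using assms by (simp add: L2_def)
  hence "integrable M (\<lambda>z. (cmod (v z + w z))\<^sup>2)"
    by (rule Bochner_Integration.integrable_bound) (simp_all only: le, measurable)
  thus ?thesis by (simp add: L2_def)
qed

lemma L2_scale: "v \<in> L2 M \<Longrightarrow> (\<lambda>z. c * v z) \<in> L2 M"
  by (auto simp: L2_def norm_mult power_mult_distrib)

lemma L2_sum:
  assumes "finite G" "\<And>p. p \<in> G \<Longrightarrow> f p \<in> L2 M"
  shows "(\<lambda>z. \<Sum>p\<in>G. c p * f p z) \<in> L2 M"
  using assms
proof (induction G rule: finite_induct)
  case empty
  show ?case by (simp add: L2_def)
next
  case (insert p G)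
  have "(\<lambda>z. c p * f p z + (\<Sum>p\<in>G. c p * f p z)) \<in> L2 M"
    using insert by (intro L2_add L2_scale) auto
  thus ?case using insert.hyps by simp
qed

lemma borel_measurable_cnj [measurable]: "cnj \<in> borel_measurable borel"
  by (intro borel_measurable_continuous_onI continuous_intros)

lemma L2_mult_cnj_integrable:
  assumes "v \<in> L2 M" "w \<in> L2 M"
  shows "integrable M (\<lambda>z. v z * cnj (w z))"
proof (rule Bochner_Integration.integrable_bound)
  have [measurable]: "v \<in> borel_measurable M" "w \<in> borel_measurable M" using assms by (auto simp: L2_def)
  show "integrable M (\<lambda>z. (cmod (v z))\<^sup>2 + (cmod (w z))\<^sup>2)" using assms by (auto simp: L2_def)
  show "(\<lambda>z. v z * cnj (w z)) \<in> borel_measurable M" by measurable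
  have "cmod (v z * cnj (w z)) \<le> norm ((cmod (v z))\<^sup>2 + (cmod (w z))\<^sup>2)" for z
  proof -
    have "0 \<le> cmod (v z) * cmod (w z)" by simp
    moreover have "2 * (cmod (v z) * cmod (w z)) \<le> (cmod (v z))\<^sup>2 + (cmod (w z))\<^sup>2"
      using sum_squares_bound[of "cmod (v z)" "cmod (w z)"] by (simp add: mult.assoc)
    ultimately have "cmod (v z) * cmod (w z) \<le> (cmod (v z))\<^sup>2 + (cmod (w z))\<^sup>2" by linarith
    thus ?thesis by (simp add: norm_mult)
  qed
  thus "AE z in M. cmod (v z * cnj (w z)) \<le> norm ((cmod (v z))\<^sup>2 + (cmod (w z))\<^sup>2)" by simp
qed

lemma basis_fun_L2_TI: "p \<in> Zstar m \<times> FS \<Longrightarrow> basis_fun m p \<in> L2 (TI m)"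
  unfolding TI_def using basis_fun_L2[of "fst p" "snd p" m UNIV] by auto

lemma coeff_add:
  assumes "v \<in> L2 (TI m)" "w \<in> L2 (TI m)" "p \<in> Zstar m \<times> FS"
  shows "coeff m (\<lambda>z. v z + w z) p = coeff m v p + coeff m w p"
  unfolding coeff_def L2_inner_def distrib_right
  using assms by (intro Bochner_Integration.integral_add L2_mult_cnj_integrable basis_fun_L2_TI)

lemma coeff_scale: "coeff m (\<lambda>z. c * v z) p = c * coeff m v p"
  unfolding coeff_def L2_inner_def by (simp add: mult.assoc)

lemma coeff_diff:
  assumes "v \<in> L2 (TI m)" "w \<in> L2 (TI m)" "p \<in> Zstar m \<times> FS"
  shows "coeff m (\<lambda>z. v z - w z) p = coeff m v p - coeff m w p"
  using coeff_add[OF assms(1) L2_scale[OF assms(2), of "-1"] assms(3)] coeff_scale[of m "-1" w p] by simp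

lemma coeff_basis_fun:
  assumes "p \<in> Zstar m \<times> FS" "q \<in> Zstar m \<times> FS"
  shows "coeff m (basis_fun m p) q = (if p = q then 1 else 0)"
  using basis_fun_orthonormal(2)[of "fst p" "snd p" m "fst q" "snd q" UNIV] assms
  by (simp add: coeff_def L2_inner_def TI_def)

lemma coeff_sum:
  assumes "finite G" "\<And>p. p \<in> G \<Longrightarrow> f p \<in> L2 (TI m)" "q \<in> Zstar m \<times> FS"
  shows "coeff m (\<lambda>z. \<Sum>p\<in>G. c p * f p z) q = (\<Sum>p\<in>G. c p * coeff m (f p) q)"
  using assms(1,2)
proof (induction G rule: finite_induct)
  case empty
  show ?case by (simp add: coeff_def L2_inner_def)
next
  case (insert p G)
  have "coeff m (\<lambda>z. c p * f p z + (\<Sum>p\<in>G. c p * f p z)) q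
      = coeff m (\<lambda>z. c p * f p z) q + coeff m (\<lambda>z. \<Sum>p\<in>G. c p * f p z) q"
  proof (rule coeff_add[OF _ _ assms(3)])
    show "(\<lambda>z. c p * f p z) \<in> L2 (TI m)" using insert.prems by (intro L2_scale) simp
    show "(\<lambda>z. \<Sum>p\<in>G. c p * f p z) \<in> L2 (TI m)" using insert by (intro L2_sum) auto
  qed
  thus ?case using insert by (simp add: coeff_scale)
qed

definition trig_legendre_sum where
  "trig_legendre_sum m G c = (\<lambda>z. \<Sum>p\<in>G. c p * basis_fun m p z)"

lemma trig_legendre_sum_L2:
  "finite G \<Longrightarrow> G \<subseteq> Zstar m \<times> FS \<Longrightarrow> trig_legendre_sum m G c \<in> L2 (TI m)"
  unfolding trig_legendre_sum_def by (intro L2_sum basis_fun_L2_TI) auto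

lemma coeff_trig_legendre_sum:
  assumes "finite G" "G \<subseteq> Zstar m \<times> FS" "q \<in> Zstar m \<times> FS"
  shows "coeff m (trig_legendre_sum m G c) q = (if q \<in> G then c q else 0)"
proof -
  have "coeff m (trig_legendre_sum m G c) q = (\<Sum>p\<in>G. c p * coeff m (basis_fun m p) q)"
    unfolding trig_legendre_sum_def
    by (rule coeff_sum) (use assms basis_fun_L2_TI in blast)+
  also have "\<dots> = (\<Sum>p\<in>G. if p = q then c q else 0)"
  proof (rule sum.cong)
    fix p assume "p \<in> G"
    thus "c p * coeff m (basis_fun m p) q = (if p = q then c q else 0)"
      using coeff_basis_fun[of p m q] assms by (metis mult.right_neutral mult_zero_right subsetD)
  qed simp
  also have "\<dots> = (if q \<in> G then c q else 0)" using assms(1) by simp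
  finally show ?thesis .
qed

text \<open>
  As soon as the finite index set contains \<open>G\<close>, the partial sum of the expansion is the function itself.
\<close>

lemma trig_legendre_sum_L2_star:
  assumes "finite G" "G \<subseteq> Zstar m \<times> FS"
  shows "trig_legendre_sum m G c \<in> L2_star m"
proof -
  let ?v = "trig_legendre_sum m G c"
  have "L2_norm (TI m) (\<lambda>z. ?v z - (\<Sum>p\<in>P. coeff m ?v p * basis_fun m p z)) = 0"
    if P: "finite P" "P \<subseteq> Zstar m \<times> FS" "G \<subseteq> P" for P
  proof -
    have "(\<Sum>p\<in>P. coeff m ?v p * basis_fun m p z) = (\<Sum>p\<in>G. c p * basis_fun m p z)" for z
      using P coeff_trig_legendre_sum[OF assms] by (intro sum.mono_neutral_cong_right) auto
    thus ?thesis by (simp add: L2_norm_def trig_legendre_sum_def)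
  qed
  hence "\<forall>\<^sub>F P in finite_subsets_at_top (Zstar m \<times> FS).
      L2_norm (TI m) (\<lambda>z. ?v z - (\<Sum>p\<in>P. coeff m ?v p * basis_fun m p z)) = 0"
    using assms by (auto simp: eventually_finite_subsets_at_top)
  thus ?thesis unfolding L2_star_def
    using trig_legendre_sum_L2[OF assms] by (auto intro: tendsto_eventually)
qed

lemma trig_legendre_sum_L2_trunc:
  assumes G: "finite G" "G \<subseteq> Zstar m \<times> FS" "\<And>k t. (k, t) \<in> G \<Longrightarrow> supp t \<subseteq> {..<s}"
  shows "trig_legendre_sum m G c \<in> L2_trunc m s"
proof -
  have "trig_legendre_sum m G c \<in> L2 (torus m \<Otimes>\<^sub>M cube {..<s})"
    unfolding trig_legendre_sum_def using G by (intro L2_sum) (auto intro!: basis_fun_L2)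
  moreover have "legendre_prod t (restrict y {..<s}) = legendre_prod t y" if "(k, t) \<in> G" for k t y
    unfolding legendre_prod_def using G(3)[OF that] by (intro prod.cong) auto
  hence "basis_fun m p (x, restrict y {..<s}) = basis_fun m p (x, y)" if "p \<in> G" for p x y
    using that by (cases p) (auto simp: basis_fun_def)
  hence "trig_legendre_sum m G c (x, restrict y {..<s}) = trig_legendre_sum m G c (x, y)" for x y
    by (simp add: trig_legendre_sum_def)
  ultimately have "\<exists>g \<in> L2 (torus m \<Otimes>\<^sub>M cube {..<s}).
      AE (x, y) in TI m. trig_legendre_sum m G c (x, y) = g (x, restrict y {..<s})"
    by (intro bexI[of _ "trig_legendre_sum m G c"]) auto
  thus ?thesis unfolding L2_trunc_def using trig_legendre_sum_L2[OF G(1,2)] by simp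
qed

section \<open>Expansion coefficients of functions of finitely many variables\<close>

text \<open>
  The Legendre product splits into a factor in the variables below \<open>s\<close> and a factor in the others. The
  second factor is itself a Legendre product with a nonzero index, hence has mean zero, while \<open>w\<close> does
  not depend on its variables. So the integral over these variables vanishes by Fubini.
\<close>

lemma coeff_eq_0_if_trunc:
  assumes w: "w \<in> L2_trunc m s" and p: "(k, t) \<in> Zstar m \<times> FS" and t: "\<not> supp t \<subseteq> {..<s}"
  shows "coeff m w (k, t) = 0"
proof -
  obtain g where g: "g \<in> L2 (torus m \<Otimes>\<^sub>M cube {..<s})"
    and ae: "AE (x, y) in TI m. w (x, y) = g (x, restrict y {..<s})"
    using w by (auto simp: L2_trunc_def)
  define T where "T = supp t \<inter> {..<s}"
  define t' where "t' = (\<lambda>i. t (i + s))"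
  have fin: "finite (supp t)" using p by (simp add: FS_def)
  have supp_t': "supp t - {..<s} = (\<lambda>i. i + s) ` supp t'"
  proof (intro equalityI subsetI)
    fix j assume "j \<in> supp t - {..<s}"
    thus "j \<in> (\<lambda>i. i + s) ` supp t'"
      by (intro image_eqI[of _ _ "j - s"]) (auto simp: supp_def t'_def)
  qed (auto simp: supp_def t'_def)
  have t': "t' \<in> FS" "t' \<noteq> (\<lambda>_. 0)"
  proof -
    have "finite ((\<lambda>i. i + s) ` supp t')" using fin supp_t' by (metis finite_Diff)
    thus "t' \<in> FS" by (simp add: FS_def finite_image_iff)
    have "supp t' \<noteq> {}" using supp_t' t by auto
    thus "t' \<noteq> (\<lambda>_. 0)" by (auto simp: supp_def)
  qed
  \<comment> \<open>the mean is the inner product with the Legendre product of index \<open>0\<close>, which is \<open>1\<close>\<close>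
  have "(LINT y|cube UNIV. legendre_prod t' y * legendre_prod (\<lambda>_. 0) y) = 0"
    using legendre_prod_orthonormal(2)[of t' "\<lambda>_. 0" UNIV] t' by (simp add: FS_def supp_def)
  hence mean0: "(LINT y|cube UNIV. legendre_prod t' y) = 0"
    by (simp add: legendre_prod_def supp_def)
  have split: "legendre_prod t (comb_seq s y1 y2)
      = (\<Prod>j\<in>T. poly (legendre (t j)) (y1 j)) * legendre_prod t' y2" for y1 y2
  proof -
    have "legendre_prod t (comb_seq s y1 y2)
        = (\<Prod>j\<in>T. poly (legendre (t j)) (comb_seq s y1 y2 j))
          * (\<Prod>j\<in>supp t - {..<s}. poly (legendre (t j)) (comb_seq s y1 y2 j))"
      unfolding legendre_prod_def T_def using fin by (subst prod.Int_Diff[of _ _ "{..<s}"]) auto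
    also have "(\<Prod>j\<in>T. poly (legendre (t j)) (comb_seq s y1 y2 j)) = (\<Prod>j\<in>T. poly (legendre (t j)) (y1 j))"
      by (rule prod.cong) (auto simp: T_def comb_seq_less)
    also have "(\<Prod>j\<in>supp t - {..<s}. poly (legendre (t j)) (comb_seq s y1 y2 j)) = legendre_prod t' y2"
      unfolding supp_t' by (subst prod.reindex) (auto simp: legendre_prod_def t'_def comb_seq_add)
    finally show ?thesis .
  qed
  have restr [measurable]: "(\<lambda>y. restrict y {..<s}) \<in> measurable (cube UNIV) (cube {..<s})"
    unfolding cube_def by (intro measurable_restrict_subset) simp
  have [measurable]: "g \<in> borel_measurable (torus m \<Otimes>\<^sub>M cube {..<s})" using g by (simp add: L2_def)
  have [measurable]: "legendre_prod t \<in> borel_measurable (cube UNIV)" by (rule borel_measurable_legendre_prod) simp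
  define G where "G = (\<lambda>(x, y). g (x, restrict y {..<s}) * cnj (trig m k x * of_real (legendre_prod t y)))"
  have [measurable]: "G \<in> borel_measurable (torus m \<Otimes>\<^sub>M cube UNIV)"
    unfolding G_def by measurable
  have wm: "(\<lambda>z. w z * cnj (basis_fun m (k, t) z)) \<in> borel_measurable (TI m)"
    using L2_mult_cnj_integrable[OF _ basis_fun_L2_TI[OF p], of w] w by (auto simp: L2_trunc_def)
  have "coeff m w (k, t) = (LINT z|TI m. w z * cnj (basis_fun m (k, t) z))"
    by (simp add: coeff_def L2_inner_def)
  also have "\<dots> = (LINT z|TI m. G z)"
  proof (rule integral_cong_AE[OF wm])
    show "G \<in> borel_measurable (TI m)" unfolding TI_def by measurable
    show "AE z in TI m. w z * cnj (basis_fun m (k, t) z) = G z"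
      using ae by eventually_elim (auto simp: G_def basis_fun_def)
  qed
  also have "\<dots> = 0"
  \<comment> \<open>the Bochner integral of a function that is not integrable is \<open>0\<close>\<close>
  proof (cases "integrable (TI m) G")
    case False
    thus ?thesis by (rule not_integrable_integral_eq)
  next
    case True
    have inner: "(LINT y|cube UNIV. G (x, y)) = 0" if x: "x \<in> space (torus m)" for x
    proof -
      define H where "H = (\<lambda>y. g (x, restrict y {..<s}) * cnj (trig m k x))"
      have [measurable]: "H \<in> borel_measurable (cube UNIV)"
        unfolding H_def using x by measurable
      have Gx: "(\<lambda>y. G (x, y)) = (\<lambda>y. H y * of_real (legendre_prod t y))"
        by (auto simp: G_def H_def)
      have m1: "(\<lambda>y. H y * complex_of_real (legendre_prod t y)) \<in> borel_measurable (cube UNIV)" by measurable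
      have m2: "(\<lambda>(y1, y2). comb_seq s y1 y2) \<in> measurable (cube UNIV \<Otimes>\<^sub>M cube UNIV) (cube UNIV)"
        unfolding cube_def by (rule measurable_comb_seq)
      \<comment> \<open>taking the first \<open>s\<close> entries from one point of the cube and the others from a second one preserves the measure\<close>
      have distr: "distr (cube UNIV \<Otimes>\<^sub>M cube UNIV) (cube UNIV) (\<lambda>(y1, y2). comb_seq s y1 y2) = cube UNIV"
        unfolding cube_def by (rule cube_UNIV.PiM_comb_seq)
      define E where "E = (\<lambda>y1 y2. H y1 * of_real (\<Prod>j\<in>T. poly (legendre (t j)) (y1 j))
          * complex_of_real (legendre_prod t' y2))"
      have Hc: "H (comb_seq s y1 y2) = H y1" for y1 y2
      proof -
        have "restrict (comb_seq s y1 y2) {..<s} = restrict y1 {..<s}" by (auto simp: comb_seq_less)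
        thus ?thesis by (simp add: H_def)
      qed
      have "(LINT y|cube UNIV. G (x, y))
          = (LINT z|(cube UNIV \<Otimes>\<^sub>M cube UNIV). (case z of (y1, y2) \<Rightarrow> E y1 y2))"
        unfolding Gx using integral_distr[OF m2 m1] unfolding distr
        by (simp add: case_prod_beta split Hc E_def mult_ac)
      also have "\<dots> = 0"
      proof (cases "integrable (cube UNIV \<Otimes>\<^sub>M cube UNIV) (\<lambda>(y1, y2). E y1 y2)")
        case False
        thus ?thesis by (rule not_integrable_integral_eq)
      next
        case True
        interpret PP: pair_prob_space "cube UNIV" "cube UNIV" by unfold_locales
        have "(LINT z|(cube UNIV \<Otimes>\<^sub>M cube UNIV). (case z of (y1, y2) \<Rightarrow> E y1 y2))
            = (LINT y1|cube UNIV. (LINT y2|cube UNIV. E y1 y2))"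
          using PP.integral_fst'[OF True] by simp
        moreover have "(LINT y2|cube UNIV. E y1 y2) = 0" for y1
          unfolding E_def using mean0 by simp
        ultimately show ?thesis by simp
      qed
      finally show ?thesis .
    qed
    have "(LINT z|TI m. G z) = (LINT x|torus m. (LINT y|cube UNIV. G (x, y)))"
      using torus_cube.integral_fst'[OF True[unfolded TI_def]] by (simp add: TI_def)
    also have "\<dots> = (LINT x|torus m. 0)" by (rule Bochner_Integration.integral_cong) (auto simp: inner)
    finally show ?thesis by simp
  qed
  finally show ?thesis .
qed

section \<open>The \<epsilon>-dimension of an ellipsoid\<close>

text \<open>
  Gaussian elimination: an equation with a nonzero coefficient at \<open>q\<close> is solved for the unknown \<open>q\<close>, and
  substitution into the other equations removes one equation and one unknown.
\<close>

lemma underdetermined_system: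
  fixes A :: "'b \<Rightarrow> 'a \<Rightarrow> 'c :: field"
  assumes "finite B" "finite G" "card B < card G"
  shows "\<exists>c. (\<exists>p\<in>G. c p \<noteq> 0) \<and> (\<forall>u\<in>B. (\<Sum>p\<in>G. c p * A u p) = 0)"
  using assms
proof (induction B arbitrary: G A rule: finite_induct)
  case empty
  hence "G \<noteq> {}" by auto
  thus ?case by (intro exI[of _ "\<lambda>_. 1"]) auto
next
  case (insert u B)
  show ?case
  proof (cases "\<forall>p\<in>G. A u p = 0")
    case True
    obtain c where "\<exists>p\<in>G. c p \<noteq> 0" "\<forall>u\<in>B. (\<Sum>p\<in>G. c p * A u p) = 0"
      using insert.IH[of G A] insert.prems insert.hyps by auto
    thus ?thesis using True by (intro exI[of _ c]) auto
  next
    case False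
    then obtain q where q: "q \<in> G" "A u q \<noteq> 0" by auto
    define A' where "A' v p = A v p - A v q * A u p / A u q" for v p
    have "card B < card (G - {q})" using insert.prems insert.hyps q by simp
    then obtain c where c: "\<exists>p\<in>G - {q}. c p \<noteq> 0" "\<And>v. v \<in> B \<Longrightarrow> (\<Sum>p\<in>G - {q}. c p * A' v p) = 0"
      using insert.IH[of "G - {q}" A'] insert.prems(1) by blast
    define S where "S v = (\<Sum>p\<in>G - {q}. c p * A v p)" for v
    define c' where "c' = c(q := - S u / A u q)"
    have sum: "(\<Sum>p\<in>G. c' p * A v p) = S v - S u * A v q / A u q" for v
    proof -
      have "(\<Sum>p\<in>G. c' p * A v p) = c' q * A v q + (\<Sum>p\<in>G - {q}. c' p * A v p)"
        using insert.prems q by (intro sum.remove) auto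
      also have "(\<Sum>p\<in>G - {q}. c' p * A v p) = S v"
        unfolding S_def by (rule sum.cong) (auto simp: c'_def)
      finally show ?thesis by (simp add: c'_def)
    qed
    have "S v - S u * A v q / A u q = 0" if "v \<in> B" for v
    proof -
      have "0 = S v - (\<Sum>p\<in>G - {q}. c p * A u p * (A v q / A u q))"
        using c(2)[OF that] by (simp add: A'_def S_def right_diff_distrib sum_subtractf mult_ac)
      also have "\<dots> = S v - S u * A v q / A u q"
        unfolding S_def sum_distrib_right[symmetric] by simp
      finally show ?thesis by simp
    qed
    moreover have "S u - S u * A u q / A u q = 0" using q by simp
    moreover have "\<exists>p\<in>G. c' p \<noteq> 0" using c(1) by (auto simp: c'_def)
    ultimately show ?thesis by (intro exI[of _ c']) (auto simp: sum)
  qed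
qed

text \<open>
  The square root of the weight in the norm of \<open>K\<close>, so that \<open>kappa / rho\<close> are the semi-axes, measured in
  \<open>K\<close>, of the unit ball of \<open>A\<close>.
\<close>

definition kappa :: "nat \<Rightarrow> real \<Rightarrow> (nat \<Rightarrow> int) \<times> (nat \<Rightarrow> nat) \<Rightarrow> real"
  where "kappa m \<beta> p = norm_inf m (fst p) powr \<beta>"

lemma K_weight_eq:
  "(case p of (k, s) \<Rightarrow> norm_inf m k powr (2 * \<beta>) * (cmod (coeff m v (k, s)))\<^sup>2)
   = (kappa m \<beta> p)\<^sup>2 * (cmod (coeff m v p))\<^sup>2"
  by (cases p) (simp add: kappa_def power2_eq_square flip: powr_add)

lemma K_norm_eq: "K_norm m \<beta> v = sqrt (\<Sum>\<^sub>\<infinity>p\<in>Zstar m \<times> FS. (kappa m \<beta> p)\<^sup>2 * (cmod (coeff m v p))\<^sup>2)"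
  unfolding K_norm_def K_weight_eq ..

lemma K_space_eq: "K_space m \<beta> = {v \<in> L2_star m.
    (\<lambda>p. (kappa m \<beta> p)\<^sup>2 * (cmod (coeff m v p))\<^sup>2) summable_on (Zstar m \<times> FS)}"
  unfolding K_space_def K_weight_eq ..

lemma weighted_sum_trig_legendre:
  fixes h :: "_ \<Rightarrow> real"
  assumes "finite G" "G \<subseteq> Zstar m \<times> FS"
  shows "(\<lambda>p. h p * (cmod (coeff m (trig_legendre_sum m G c) p))\<^sup>2) summable_on (Zstar m \<times> FS)"
    and "(\<Sum>\<^sub>\<infinity>p\<in>Zstar m \<times> FS. h p * (cmod (coeff m (trig_legendre_sum m G c) p))\<^sup>2)
         = (\<Sum>p\<in>G. h p * (cmod (c p))\<^sup>2)"
proof -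
  let ?f = "\<lambda>p. h p * (cmod (coeff m (trig_legendre_sum m G c) p))\<^sup>2"
  have z: "?f p = 0" if "p \<in> Zstar m \<times> FS - G" for p
    using that coeff_trig_legendre_sum[OF assms, of p c] by auto
  have g: "?f p = h p * (cmod (c p))\<^sup>2" if "p \<in> G" for p
    using that coeff_trig_legendre_sum[OF assms, of p c] assms by auto
  have "?f summable_on (Zstar m \<times> FS) \<longleftrightarrow> (\<lambda>p. h p * (cmod (c p))\<^sup>2) summable_on G"
    by (rule summable_on_cong_neutral) (use z g assms in blast)+
  thus "?f summable_on (Zstar m \<times> FS)" using assms by simp
  have "infsum ?f (Zstar m \<times> FS) = infsum (\<lambda>p. h p * (cmod (c p))\<^sup>2) G"
    by (rule infsum_cong_neutral) (use z g assms in blast)+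
  thus "infsum ?f (Zstar m \<times> FS) = (\<Sum>p\<in>G. h p * (cmod (c p))\<^sup>2)" using assms by simp
qed

lemma trig_legendre_sum_K_space:
  "finite G \<Longrightarrow> G \<subseteq> Zstar m \<times> FS \<Longrightarrow> trig_legendre_sum m G c \<in> K_space m \<beta>"
  by (simp add: K_space_eq trig_legendre_sum_L2_star weighted_sum_trig_legendre(1))

lemma trig_legendre_sum_A_space:
  "finite G \<Longrightarrow> G \<subseteq> Zstar m \<times> FS \<Longrightarrow> trig_legendre_sum m G c \<in> A_space m \<alpha> b"
  by (simp add: A_space_def trig_legendre_sum_L2_star weighted_sum_trig_legendre(1))

lemma trig_legendre_sum_in_span:
  assumes "finite G"
  shows "trig_legendre_sum m G c \<in> cfun.span (basis_fun m ` G)"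
  using assms
proof (induction G rule: finite_induct)
  case empty
  have "trig_legendre_sum m {} c = 0" by (simp add: trig_legendre_sum_def zero_fun_def)
  thus ?case using cfun.span_zero by metis
next
  case (insert p G)
  have "trig_legendre_sum m (insert p G) c = cfun_scale (c p) (basis_fun m p) + trig_legendre_sum m G c"
    using insert.hyps by (simp add: trig_legendre_sum_def cfun_scale_def fun_eq_iff)
  moreover have "trig_legendre_sum m G c \<in> cfun.span (basis_fun m ` insert p G)"
    using insert.IH cfun.span_mono[of "basis_fun m ` G" "basis_fun m ` insert p G"] by blast
  moreover have "cfun_scale (c p) (basis_fun m p) \<in> cfun.span (basis_fun m ` insert p G)"
    by (intro cfun.span_scale cfun.span_base) simp
  ultimately show ?case using cfun.span_add by metis
qed

lemma span_basis_fun_subset: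
  assumes "finite G"
  shows "cfun.span (basis_fun m ` G) \<subseteq> range (trig_legendre_sum m G)"
proof (rule cfun.span_minimal)
  show "basis_fun m ` G \<subseteq> range (trig_legendre_sum m G)"
  proof safe
    fix k t assume p: "(k, t) \<in> G"
    have "basis_fun m (k, t) = trig_legendre_sum m G (\<lambda>q. if q = (k, t) then 1 else 0)"
      using assms p by (auto simp: trig_legendre_sum_def fun_eq_iff if_distrib[of "\<lambda>c. c * _"] cong: if_cong)
    thus "basis_fun m (k, t) \<in> range (trig_legendre_sum m G)" by (simp only: rangeI)
  qed
  show "cfun.subspace (range (trig_legendre_sum m G))"
  proof (rule cfun.subspaceI)
    have "0 = trig_legendre_sum m G (\<lambda>_. 0)" by (simp add: trig_legendre_sum_def fun_eq_iff)
    thus "0 \<in> range (trig_legendre_sum m G)" by (metis rangeI)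
    fix v w assume "v \<in> range (trig_legendre_sum m G)" "w \<in> range (trig_legendre_sum m G)"
    then obtain c d where "v = trig_legendre_sum m G c" "w = trig_legendre_sum m G d" by blast
    hence "v + w = trig_legendre_sum m G (\<lambda>p. c p + d p)"
      by (simp add: trig_legendre_sum_def fun_eq_iff sum.distrib algebra_simps)
    thus "v + w \<in> range (trig_legendre_sum m G)" by (metis rangeI)
  next
    fix a v assume "v \<in> range (trig_legendre_sum m G)"
    then obtain c where "v = trig_legendre_sum m G c" by blast
    hence "cfun_scale a v = trig_legendre_sum m G (\<lambda>p. a * c p)"
      by (simp add: trig_legendre_sum_def cfun_scale_def fun_eq_iff sum_distrib_left mult.assoc)
    thus "cfun_scale a v \<in> range (trig_legendre_sum m G)" by (metis rangeI)
  qed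
qed

text \<open>
  The error consists of the coefficients of \<open>w\<close> in \<open>I - G\<close>, where the semi-axes are at most \<open>\<epsilon>\<close>.
\<close>

lemma K_norm_diff_le:
  assumes w: "w \<in> A_space m \<alpha> b" "A_norm m \<alpha> b w \<le> 1"
    and I: "\<And>p. p \<in> Zstar m \<times> FS - I \<Longrightarrow> coeff m w p = 0"
    and G: "finite G" "G \<subseteq> Zstar m \<times> FS" and \<epsilon>: "\<epsilon> \<ge> 0"
    and le: "\<And>p. p \<in> I - G \<Longrightarrow> kappa m \<beta> p \<le> \<epsilon> * rho m \<alpha> b p"
  shows "K_norm m \<beta> (w - trig_legendre_sum m G (coeff m w)) \<le> \<epsilon>"
proof -
  let ?Z = "Zstar m \<times> FS" and ?v = "trig_legendre_sum m G (coeff m w)"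
  have wL: "w \<in> L2 (TI m)" and sw: "(\<lambda>p. (rho m \<alpha> b p)\<^sup>2 * (cmod (coeff m w p))\<^sup>2) summable_on ?Z"
    using w by (auto simp: A_space_def L2_star_def)
  have cd: "coeff m (w - ?v) p = (if p \<in> G then 0 else coeff m w p)" if "p \<in> ?Z" for p
    using coeff_diff[OF wL trig_legendre_sum_L2[OF G] that] coeff_trig_legendre_sum[OF G that]
    by (simp add: fun_diff_def)
  have pw: "(kappa m \<beta> p)\<^sup>2 * (cmod (coeff m (w - ?v) p))\<^sup>2
      \<le> \<epsilon>\<^sup>2 * ((rho m \<alpha> b p)\<^sup>2 * (cmod (coeff m w p))\<^sup>2)" if p: "p \<in> ?Z" for p
  proof (cases "p \<in> I - G")
    case True
    have "(kappa m \<beta> p)\<^sup>2 \<le> (\<epsilon> * rho m \<alpha> b p)\<^sup>2"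
      using le[OF True] by (intro power_mono) (auto simp: kappa_def)
    hence "(kappa m \<beta> p)\<^sup>2 * (cmod (coeff m w p))\<^sup>2 \<le> (\<epsilon> * rho m \<alpha> b p)\<^sup>2 * (cmod (coeff m w p))\<^sup>2"
      by (rule mult_right_mono) simp
    thus ?thesis using True by (simp add: cd[OF p] power_mult_distrib mult.assoc)
  next
    case False
    thus ?thesis using I[of p] p by (auto simp: cd[OF p])
  qed
  have s2: "(\<lambda>p. \<epsilon>\<^sup>2 * ((rho m \<alpha> b p)\<^sup>2 * (cmod (coeff m w p))\<^sup>2)) summable_on ?Z"
    by (intro summable_on_cmult_right sw)
  have s1: "(\<lambda>p. (kappa m \<beta> p)\<^sup>2 * (cmod (coeff m (w - ?v) p))\<^sup>2) summable_on ?Z"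
    by (rule summable_on_comparison_test[OF s2 pw]) auto
  have "(\<Sum>\<^sub>\<infinity>p\<in>?Z. (kappa m \<beta> p)\<^sup>2 * (cmod (coeff m (w - ?v) p))\<^sup>2)
      \<le> (\<Sum>\<^sub>\<infinity>p\<in>?Z. \<epsilon>\<^sup>2 * ((rho m \<alpha> b p)\<^sup>2 * (cmod (coeff m w p))\<^sup>2))"
    by (rule infsum_mono[OF s1 s2 pw])
  also have "\<dots> = \<epsilon>\<^sup>2 * (\<Sum>\<^sub>\<infinity>p\<in>?Z. (rho m \<alpha> b p)\<^sup>2 * (cmod (coeff m w p))\<^sup>2)"
    by (rule infsum_cmult_right')
  also have "\<dots> \<le> \<epsilon>\<^sup>2 * 1"
    using w(2) by (intro mult_left_mono) (auto simp: A_norm_def)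
  finally show ?thesis using \<epsilon> by (simp add: K_norm_eq real_le_lsqrt)
qed

text \<open>
  In the weighted norm on the coordinates in \<open>G\<close> one has \<open>|c - v|\<^sup>2 \<ge> |c|\<^sup>2 - 2 Re \<langle>v, c\<rangle> = |c|\<^sup>2\<close>, and
  the other coordinates can only increase the norm of the difference.
\<close>

lemma K_norm_diff_ge:
  assumes G: "finite G" "G \<subseteq> Zstar m \<times> FS" and v: "v \<in> K_space m \<beta>"
    and orth: "(\<Sum>p\<in>G. cnj (c p) * ((kappa m \<beta> p)\<^sup>2 * coeff m v p)) = 0"
  shows "K_norm m \<beta> (trig_legendre_sum m G c - v) \<ge> sqrt (\<Sum>p\<in>G. (kappa m \<beta> p)\<^sup>2 * (cmod (c p))\<^sup>2)"
proof -
  let ?Z = "Zstar m \<times> FS" and ?w = "trig_legendre_sum m G c"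
  have vL: "v \<in> L2 (TI m)" and sv: "(\<lambda>p. (kappa m \<beta> p)\<^sup>2 * (cmod (coeff m v p))\<^sup>2) summable_on ?Z"
    using v by (auto simp: K_space_eq L2_star_def)
  have sw: "(\<lambda>p. (kappa m \<beta> p)\<^sup>2 * (cmod (coeff m ?w p))\<^sup>2) summable_on ?Z"
    by (rule weighted_sum_trig_legendre(1)[OF G])
  have cd: "coeff m (?w - v) p = coeff m ?w p - coeff m v p" if "p \<in> ?Z" for p
    using coeff_diff[OF trig_legendre_sum_L2[OF G] vL that] by (simp add: fun_diff_def)
  have sq: "(cmod (x - y))\<^sup>2 \<le> 2 * (cmod x)\<^sup>2 + 2 * (cmod y)\<^sup>2" for x y
  proof -
    have "(cmod (x - y))\<^sup>2 \<le> (cmod x + cmod y)\<^sup>2"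
      by (intro power_mono norm_triangle_ineq4) simp
    also have "\<dots> \<le> 2 * (cmod x)\<^sup>2 + 2 * (cmod y)\<^sup>2"
      using sum_squares_bound[of "cmod x" "cmod y"] by (simp add: power2_sum)
    finally show ?thesis .
  qed
  have s: "(\<lambda>p. (kappa m \<beta> p)\<^sup>2 * (cmod (coeff m (?w - v) p))\<^sup>2) summable_on ?Z"
  proof (rule summable_on_comparison_test)
    show "(\<lambda>p. 2 * ((kappa m \<beta> p)\<^sup>2 * (cmod (coeff m ?w p))\<^sup>2)
        + 2 * ((kappa m \<beta> p)\<^sup>2 * (cmod (coeff m v p))\<^sup>2)) summable_on ?Z"
      by (intro summable_on_add summable_on_cmult_right sv sw)
    fix p assume p: "p \<in> ?Z"
    have "(kappa m \<beta> p)\<^sup>2 * (cmod (coeff m ?w p - coeff m v p))\<^sup>2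
        \<le> (kappa m \<beta> p)\<^sup>2 * (2 * (cmod (coeff m ?w p))\<^sup>2 + 2 * (cmod (coeff m v p))\<^sup>2)"
      by (intro mult_left_mono sq) simp
    thus "(kappa m \<beta> p)\<^sup>2 * (cmod (coeff m (?w - v) p))\<^sup>2
      \<le> 2 * ((kappa m \<beta> p)\<^sup>2 * (cmod (coeff m ?w p))\<^sup>2) + 2 * ((kappa m \<beta> p)\<^sup>2 * (cmod (coeff m v p))\<^sup>2)"
      by (simp add: cd[OF p] algebra_simps)
  qed simp
  have expand: "(cmod (x - y))\<^sup>2 \<ge> (cmod x)\<^sup>2 - 2 * Re (cnj x * y)" for x y
  proof -
    have "(cmod (x - y))\<^sup>2 = (cmod x)\<^sup>2 - 2 * Re (cnj x * y) + (cmod y)\<^sup>2"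
      by (simp add: cmod_power2 power2_diff algebra_simps)
    thus ?thesis by simp
  qed
  have "(\<Sum>p\<in>G. (kappa m \<beta> p)\<^sup>2 * (cmod (c p))\<^sup>2)
      = (\<Sum>p\<in>G. (kappa m \<beta> p)\<^sup>2 * (cmod (c p))\<^sup>2)
        - 2 * Re (\<Sum>p\<in>G. cnj (c p) * ((kappa m \<beta> p)\<^sup>2 * coeff m v p))"
    unfolding orth by simp
  also have "\<dots> = (\<Sum>p\<in>G. (kappa m \<beta> p)\<^sup>2 * ((cmod (c p))\<^sup>2 - 2 * Re (cnj (c p) * coeff m v p)))"
  proof -
    have "Re (cnj (c p) * ((kappa m \<beta> p)\<^sup>2 * coeff m v p)) = (kappa m \<beta> p)\<^sup>2 * Re (cnj (c p) * coeff m v p)" for p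
      by (simp add: algebra_simps flip: of_real_power)
    thus ?thesis
      by (simp only: Re_sum sum_distrib_left sum_subtractf[symmetric]) (simp add: algebra_simps)
  qed
  also have "\<dots> \<le> (\<Sum>p\<in>G. (kappa m \<beta> p)\<^sup>2 * (cmod (c p - coeff m v p))\<^sup>2)"
    by (intro sum_mono mult_left_mono expand) simp
  also have "\<dots> = (\<Sum>p\<in>G. (kappa m \<beta> p)\<^sup>2 * (cmod (coeff m (?w - v) p))\<^sup>2)"
  proof (rule sum.cong)
    fix p assume "p \<in> G"
    moreover from this have "p \<in> ?Z" using G by blast
    ultimately show "(kappa m \<beta> p)\<^sup>2 * (cmod (c p - coeff m v p))\<^sup>2
        = (kappa m \<beta> p)\<^sup>2 * (cmod (coeff m (?w - v) p))\<^sup>2"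
      using coeff_trig_legendre_sum[OF G, of p c] by (simp add: cd)
  qed simp
  also have "\<dots> \<le> (\<Sum>\<^sub>\<infinity>p\<in>?Z. (kappa m \<beta> p)\<^sup>2 * (cmod (coeff m (?w - v) p))\<^sup>2)"
    using s G by (intro finite_sum_le_infsum) auto
  finally show ?thesis unfolding K_norm_eq by (rule real_sqrt_le_mono)
qed

text \<open>
  The set \<open>I\<close> contains the indices of all nonzero coefficients of elements of \<open>W\<close>; it is the full index set for
  the whole ball and those with \<open>supp t\<close> in the first \<open>s\<close> variables for the truncated one.
\<close>

lemma eps_dim_le_card:
  assumes I: "I \<subseteq> Zstar m \<times> FS" and \<epsilon>: "\<epsilon> > 0"
    and G: "finite G" "G \<subseteq> I" "\<And>p. p \<in> I - G \<Longrightarrow> kappa m \<beta> p \<le> \<epsilon> * rho m \<alpha> b p"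
    and X: "\<And>c. trig_legendre_sum m G c \<in> X"
    and W: "\<And>w. w \<in> W \<Longrightarrow> w \<in> A_space m \<alpha> b \<and> A_norm m \<alpha> b w \<le> 1
              \<and> (\<forall>p\<in>Zstar m \<times> FS - I. coeff m w p = 0)"
  shows "eps_dim \<epsilon> W X (K_norm m \<beta>) \<le> enat (card G)"
proof -
  define M where "M = cfun.span (basis_fun m ` G)"
  have GZ: "G \<subseteq> Zstar m \<times> FS" using G I by blast
  have "M \<subseteq> X" unfolding M_def using span_basis_fun_subset[OF G(1), of m] X by blast
  moreover have "cfun.subspace M" unfolding M_def by (rule cfun.subspace_span)
  moreover have "\<exists>B. finite B \<and> card B \<le> card G \<and> cfun.span B = M"
    unfolding M_def using G(1) by (intro exI[of _ "basis_fun m ` G"]) (simp add: card_image_le)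
  moreover have "(SUP w\<in>W. INF v\<in>M. ereal (K_norm m \<beta> (w - v))) \<le> ereal \<epsilon>"
  proof (rule SUP_least)
    fix w assume w: "w \<in> W"
    have "(INF v\<in>M. ereal (K_norm m \<beta> (w - v)))
        \<le> ereal (K_norm m \<beta> (w - trig_legendre_sum m G (coeff m w)))"
      unfolding M_def by (rule INF_lower) (rule trig_legendre_sum_in_span[OF G(1)])
    also have "K_norm m \<beta> (w - trig_legendre_sum m G (coeff m w)) \<le> \<epsilon>"
      using W[OF w] \<epsilon> G GZ by (intro K_norm_diff_le[where I = I and \<alpha> = \<alpha> and b = b]) auto
    finally show "(INF v\<in>M. ereal (K_norm m \<beta> (w - v))) \<le> ereal \<epsilon>" by simp
  qed
  ultimately show ?thesis unfolding eps_dim_def by (intro Inf_lower) blast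
qed

text \<open>
  A subspace of dimension less than \<open>card G\<close> imposes fewer orthogonality conditions than there are
  coordinates in \<open>G\<close>, so a nonzero \<open>w\<close> with coordinates in \<open>G\<close> is orthogonal to it. The distance of \<open>w\<close>
  from the subspace is then at least its norm in \<open>K\<close>. If \<open>w\<close> is normalized in \<open>A\<close>, this norm exceeds \<open>\<epsilon>\<close>,
  since every semi-axis in \<open>G\<close> does.
\<close>

lemma card_le_eps_dim:
  assumes G: "finite G" "G \<subseteq> Zstar m \<times> FS" and \<epsilon>: "\<epsilon> > 0"
    and lt: "\<And>p. p \<in> G \<Longrightarrow> 0 < rho m \<alpha> b p \<and> \<epsilon> * rho m \<alpha> b p < kappa m \<beta> p"
    and X: "X \<subseteq> K_space m \<beta>"
    and W: "\<And>c. A_norm m \<alpha> b (trig_legendre_sum m G c) \<le> 1 \<Longrightarrow> trig_legendre_sum m G c \<in> W"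
  shows "enat (card G) \<le> eps_dim \<epsilon> W X (K_norm m \<beta>)"
  unfolding eps_dim_def
proof (rule Inf_greatest, safe)
  fix n M B
  assume MX: "cfun.span B \<subseteq> X" and B: "finite B" "card B \<le> n"
    and sup: "(SUP w\<in>W. INF v\<in>cfun.span B. ereal (K_norm m \<beta> (w - v))) \<le> ereal \<epsilon>"
  show "enat (card G) \<le> enat n"
  proof (rule ccontr)
    assume "\<not> enat (card G) \<le> enat n"
    hence "card B < card G" using B by simp
    then obtain c where c: "\<exists>p\<in>G. c p \<noteq> 0"
      and orth: "\<And>u. u \<in> B \<Longrightarrow> (\<Sum>p\<in>G. c p * ((kappa m \<beta> p)\<^sup>2 * coeff m u p)) = 0"
      using underdetermined_system[of B G "\<lambda>u p. (kappa m \<beta> p)\<^sup>2 * coeff m u p"] B(1) G(1) by blast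
    define S where "S = (\<Sum>p\<in>G. (rho m \<alpha> b p)\<^sup>2 * (cmod (c p))\<^sup>2)"
    obtain q where q: "q \<in> G" "c q \<noteq> 0" using c by blast
    have "0 < (rho m \<alpha> b q)\<^sup>2 * (cmod (c q))\<^sup>2" using lt[OF q(1)] q(2) by simp
    also have "\<dots> \<le> S" unfolding S_def using q G by (intro member_le_sum) auto
    finally have S: "S > 0" .
    \<comment> \<open>\<open>K_norm_diff_ge\<close> pairs \<open>v\<close> with the conjugate coordinates of \<open>w\<close>, whence the conjugate\<close>
    define d where "d p = cnj (c p) / of_real (sqrt S)" for p
    have d2: "(cmod (d p))\<^sup>2 = (cmod (c p))\<^sup>2 / S" for p
      using S by (simp add: d_def norm_divide power_divide)
    define w where "w = trig_legendre_sum m G d"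
    define R where "R = (\<Sum>p\<in>G. (kappa m \<beta> p)\<^sup>2 * (cmod (d p))\<^sup>2)"
    have A1: "(\<Sum>p\<in>G. (rho m \<alpha> b p)\<^sup>2 * (cmod (d p))\<^sup>2) = 1"
      using S unfolding d2 times_divide_eq_right sum_divide_distrib[symmetric] by (simp add: S_def)
    have "A_norm m \<alpha> b w = 1"
      unfolding A_norm_def w_def weighted_sum_trig_legendre(2)[OF G] A1 by simp
    hence wW: "w \<in> W" unfolding w_def by (intro W) simp
    have "\<epsilon>\<^sup>2 = (\<Sum>p\<in>G. (\<epsilon> * rho m \<alpha> b p)\<^sup>2 * (cmod (d p))\<^sup>2)"
      using A1 by (simp add: power_mult_distrib mult.assoc flip: sum_distrib_left)
    also have "\<dots> < R"
      unfolding R_def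
    proof (rule sum_strict_mono_ex1[OF G(1)])
      have sq: "(\<epsilon> * rho m \<alpha> b p)\<^sup>2 < (kappa m \<beta> p)\<^sup>2" if "p \<in> G" for p
        using lt[OF that] \<epsilon> by (intro power_strict_mono) auto
      show "\<forall>p\<in>G. (\<epsilon> * rho m \<alpha> b p)\<^sup>2 * (cmod (d p))\<^sup>2 \<le> (kappa m \<beta> p)\<^sup>2 * (cmod (d p))\<^sup>2"
        by (intro ballI mult_right_mono less_imp_le[OF sq]) auto
      have "0 < (cmod (d q))\<^sup>2" using S q by (simp add: d2)
      thus "\<exists>p\<in>G. (\<epsilon> * rho m \<alpha> b p)\<^sup>2 * (cmod (d p))\<^sup>2 < (kappa m \<beta> p)\<^sup>2 * (cmod (d p))\<^sup>2"
        using sq[OF q(1)] q(1) by (intro bexI[of _ q]) (auto intro: mult_strict_right_mono)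
    qed
    finally have R: "\<epsilon> < sqrt R" by (rule real_less_rsqrt)
    \<comment> \<open>orthogonality to the spanning set carries over to its span\<close>
    define Orth where "Orth = {v \<in> L2 (TI m). (\<Sum>p\<in>G. c p * ((kappa m \<beta> p)\<^sup>2 * coeff m v p)) = 0}"
    have "cfun.subspace Orth"
    proof (rule cfun.subspaceI)
      show "0 \<in> Orth" by (simp add: Orth_def L2_def zero_fun_def coeff_def L2_inner_def)
      fix u v assume u: "u \<in> Orth" and v: "v \<in> Orth"
      have "coeff m (u + v) p = coeff m u p + coeff m v p" if "p \<in> G" for p
        using coeff_add[of u m v p] u v that G by (auto simp: Orth_def plus_fun_def)
      hence "(\<Sum>p\<in>G. c p * ((kappa m \<beta> p)\<^sup>2 * coeff m (u + v) p))
          = (\<Sum>p\<in>G. c p * ((kappa m \<beta> p)\<^sup>2 * coeff m u p)) + (\<Sum>p\<in>G. c p * ((kappa m \<beta> p)\<^sup>2 * coeff m v p))"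
        unfolding sum.distrib[symmetric] by (intro sum.cong) (auto simp: algebra_simps)
      thus "u + v \<in> Orth" using u v L2_add[of u "TI m" v] by (simp add: Orth_def plus_fun_def)
    next
      fix a u assume u: "u \<in> Orth"
      have "(\<Sum>p\<in>G. c p * ((kappa m \<beta> p)\<^sup>2 * coeff m (cfun_scale a u) p))
          = a * (\<Sum>p\<in>G. c p * ((kappa m \<beta> p)\<^sup>2 * coeff m u p))"
        unfolding sum_distrib_left cfun_scale_def coeff_scale by (intro sum.cong) auto
      thus "cfun_scale a u \<in> Orth" using u L2_scale[of u "TI m" a] by (simp add: Orth_def cfun_scale_def)
    qed
    moreover have "B \<subseteq> Orth"
    proof
      fix u assume u: "u \<in> B"
      hence "u \<in> K_space m \<beta>" using MX X cfun.span_base[of u B] by blast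
      hence "u \<in> L2 (TI m)" by (simp add: K_space_eq L2_star_def)
      thus "u \<in> Orth" using orth[OF u] by (simp add: Orth_def)
    qed
    ultimately have span: "cfun.span B \<subseteq> Orth" by (intro cfun.span_minimal)
    have "ereal (sqrt R) \<le> (INF v\<in>cfun.span B. ereal (K_norm m \<beta> (w - v)))"
    proof (rule INF_greatest)
      fix v assume v: "v \<in> cfun.span B"
      have "(\<Sum>p\<in>G. cnj (d p) * ((kappa m \<beta> p)\<^sup>2 * coeff m v p))
          = (\<Sum>p\<in>G. c p * ((kappa m \<beta> p)\<^sup>2 * coeff m v p)) / of_real (sqrt S)"
        by (simp add: d_def sum_divide_distrib)
      also have "\<dots> = 0" using span v by (auto simp: Orth_def)
      finally have orth_v: "(\<Sum>p\<in>G. cnj (d p) * ((kappa m \<beta> p)\<^sup>2 * coeff m v p)) = 0" .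
      have vK: "v \<in> K_space m \<beta>" using v MX X by blast
      show "ereal (sqrt R) \<le> ereal (K_norm m \<beta> (w - v))"
        unfolding w_def R_def ereal_less_eq by (rule K_norm_diff_ge[OF G vK orth_v])
    qed
    also have "\<dots> \<le> (SUP w\<in>W. INF v\<in>cfun.span B. ereal (K_norm m \<beta> (w - v)))"
      by (rule SUP_upper[OF wW])
    also have "\<dots> \<le> ereal \<epsilon>" by (rule sup)
    finally show False using R by simp
  qed
qed

section \<open>Counting the long semi-axes\<close>

lemma norm_inf_le_iff:
  assumes "m \<ge> 1"
  shows "norm_inf m k \<le> r \<longleftrightarrow> (\<forall>j<m. \<bar>k j\<bar> \<le> \<lfloor>r\<rfloor>)"
proof -
  have "norm_inf m k \<le> r \<longleftrightarrow> Max ((\<lambda>j. \<bar>k j\<bar>) ` {..<m}) \<le> \<lfloor>r\<rfloor>"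
    by (simp add: norm_inf_def le_floor_iff)
  also have "\<dots> \<longleftrightarrow> (\<forall>j<m. \<bar>k j\<bar> \<le> \<lfloor>r\<rfloor>)"
    using assms by (subst Max_le_iff) (auto simp: lessThan_empty_iff)
  finally show ?thesis .
qed

lemma norm_inf_ge_1:
  assumes "m \<ge> 1" "k \<in> Zstar m"
  shows "norm_inf m k \<ge> 1"
proof -
  have "\<forall>j<m. k j \<noteq> 0" using assms(2) by (simp add: Zstar_def PiE_iff)
  hence "k 0 \<noteq> 0" using assms(1) by simp
  hence "1 \<le> \<bar>k 0\<bar>" by simp
  also have "\<dots> \<le> Max ((\<lambda>j. \<bar>k j\<bar>) ` {..<m})" using assms(1) by (intro Max_ge) auto
  finally show ?thesis by (simp add: norm_inf_def)
qed

lemma card_norm_inf_le: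
  assumes "m \<ge> 1"
  shows "finite {k \<in> Zstar m. norm_inf m k \<le> r}"
    and "card {k \<in> Zstar m. norm_inf m k \<le> r} = (2 * nat \<lfloor>r\<rfloor>) ^ m"
proof -
  define D where "D = {n. n \<noteq> 0 \<and> \<bar>n\<bar> \<le> \<lfloor>r\<rfloor>}"
  have D: "D = {- \<lfloor>r\<rfloor>..\<lfloor>r\<rfloor>} - {0}" by (auto simp: D_def)
  have eq: "{k \<in> Zstar m. norm_inf m k \<le> r} = (\<Pi>\<^sub>E j\<in>{..<m}. D)"
    unfolding norm_inf_le_iff[OF assms] Zstar_def D_def by (rule set_eqI, simp add: PiE_iff) blast
  show "finite {k \<in> Zstar m. norm_inf m k \<le> r}" unfolding eq by (intro finite_PiE) (auto simp: D)
  have "card D = 2 * nat \<lfloor>r\<rfloor>"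
    by (cases "\<lfloor>r\<rfloor> \<ge> 0") (auto simp: D card_Diff_singleton_if nat_add_distrib nat_mult_distrib)
  thus "card {k \<in> Zstar m. norm_inf m k \<le> r} = (2 * nat \<lfloor>r\<rfloor>) ^ m"
    unfolding eq by (simp add: card_PiE)
qed

lemma rho_eq: "rho m \<alpha> b (k, s) = norm_inf m k powr \<alpha> / multinom b s"
proof -
  have "mi_pow_neg b s = 1 / mi_pow b s"
    unfolding mi_pow_neg_def mi_pow_def by (simp add: power_int_minus prod_inversef[symmetric] o_def divide_inverse)
  thus ?thesis by (simp add: rho_def multinom_def)
qed

lemma threshold_iff:
  assumes m: "m \<ge> 1" and ab: "\<alpha> > \<beta>" and b: "\<And>j. b j > 0" and \<epsilon>: "\<epsilon> > 0" and k: "k \<in> Zstar m"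
  shows "\<epsilon> * rho m \<alpha> b (k, s) < kappa m \<beta> (k, s)
    \<longleftrightarrow> norm_inf m k < (multinom b s / \<epsilon>) powr (1 / (\<alpha> - \<beta>))"
proof -
  define x where "x = norm_inf m k"
  define c where "c = multinom b s"
  have x: "x \<ge> 1" using norm_inf_ge_1[OF m k] by (simp add: x_def)
  have c: "c > 0" using multinom_pos[of b s] b by (simp add: c_def)
  have "\<epsilon> * rho m \<alpha> b (k, s) < kappa m \<beta> (k, s) \<longleftrightarrow> \<epsilon> * (x powr \<alpha> / c) < x powr \<beta>"
    by (simp add: rho_eq kappa_def x_def c_def)
  also have "x powr \<alpha> = x powr (\<alpha> - \<beta>) * x powr \<beta>" by (simp flip: powr_add)
  also have "\<epsilon> * (x powr (\<alpha> - \<beta>) * x powr \<beta> / c) < x powr \<beta> \<longleftrightarrow> x powr (\<alpha> - \<beta>) < c / \<epsilon>"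
    using x c \<epsilon> by (simp add: field_simps)
  also have "\<dots> \<longleftrightarrow> x < (c / \<epsilon>) powr (1 / (\<alpha> - \<beta>))"
  proof -
    have "x powr (\<alpha> - \<beta>) < c / \<epsilon> \<longleftrightarrow> (x powr (\<alpha> - \<beta>)) powr (1 / (\<alpha> - \<beta>)) < (c / \<epsilon>) powr (1 / (\<alpha> - \<beta>))"
    proof -
      have "u < v \<longleftrightarrow> u powr e < v powr e" if "u > 0" "v > 0" "e > 0" for u v e :: real
        using that powr_less_mono2[of e u v] powr_mono2[of e v u] by (cases "u < v") auto
      from this[of "x powr (\<alpha> - \<beta>)" "c / \<epsilon>" "1 / (\<alpha> - \<beta>)"] show ?thesis using x c \<epsilon> ab by simp
    qed
    thus ?thesis using x ab by (simp add: powr_powr)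
  qed
  finally show ?thesis by (simp add: x_def c_def)
qed

lemma finite_summable_superlevel:
  fixes f :: "'a \<Rightarrow> real"
  assumes "f summable_on A" "\<And>x. x \<in> A \<Longrightarrow> f x \<ge> 0" "\<delta> > 0"
  shows "finite {x \<in> A. f x \<ge> \<delta>}"
proof (rule ccontr)
  assume inf: "infinite {x \<in> A. f x \<ge> \<delta>}"
  obtain n :: nat where n: "infsum f A < real n * \<delta>"
    using reals_Archimedean3[OF assms(3)] by blast
  obtain B where B: "finite B" "card B = n" "B \<subseteq> {x \<in> A. f x \<ge> \<delta>}"
    using infinite_arbitrarily_large[OF inf, of n] by blast
  have "real n * \<delta> = (\<Sum>x\<in>B. \<delta>)" using B by simp
  also have "\<dots> \<le> sum f B" using B by (intro sum_mono) auto
  also have "\<dots> \<le> infsum f A" using B assms by (intro finite_sum_le_infsum) auto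
  finally show False using n by simp
qed

text \<open>
  For each \<open>s\<close> there are at most \<open>2\<^sup>m r\<^sup>m\<close> vectors \<open>k\<close> with \<open>|k| \<le> r\<close>, where
  \<open>r\<^sup>m = (c(s) / \<epsilon>)\<^sup>p\<close> and \<open>p = m / (\<alpha> - \<beta>)\<close>. There are none unless \<open>r > 1\<close>, since nonzero integers have modulus at
  least \<open>1\<close>; so only the finitely many \<open>s\<close> with \<open>c(s)\<^sup>p \<ge> \<epsilon>\<^sup>p\<close> occur.
\<close>

lemma card_threshold_le:
  fixes m :: nat and \<alpha> \<beta> \<epsilon> :: real and b :: "nat \<Rightarrow> real"
  assumes m: "m \<ge> 1" and ab: "\<alpha> > \<beta>" and b: "\<And>j. b j > 0" and \<epsilon>: "\<epsilon> > 0"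
    and sum: "(\<lambda>s. multinom b s powr (real m / (\<alpha> - \<beta>))) summable_on FS"
  defines "G \<equiv> {p \<in> Zstar m \<times> FS. \<epsilon> * rho m \<alpha> b p < kappa m \<beta> p}"
  shows "finite G"
    and "real (card G) \<le> 2 ^ m * (\<Sum>\<^sub>\<infinity>s\<in>FS. multinom b s powr (real m / (\<alpha> - \<beta>))) * \<epsilon> powr (- real m / (\<alpha> - \<beta>))"
proof -
  define p where "p = real m / (\<alpha> - \<beta>)"
  define r where "r s = (multinom b s / \<epsilon>) powr (1 / (\<alpha> - \<beta>))" for s
  have c: "multinom b s > 0" for s using b by (rule multinom_pos)
  have p: "p > 0" using m ab by (simp add: p_def)
  have rm: "r s ^ m = multinom b s powr p * \<epsilon> powr (- p)" for s
  proof -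
    have "r s > 0" using c[of s] \<epsilon> by (simp add: r_def)
    hence "r s ^ m = (multinom b s / \<epsilon>) powr p"
      by (simp add: r_def p_def powr_powr flip: powr_realpow)
    thus ?thesis using c[of s] \<epsilon> by (simp add: powr_divide powr_minus field_simps)
  qed
  define F where "F = {s \<in> FS. multinom b s powr p \<ge> \<epsilon> powr p}"
  have F: "finite F"
    unfolding F_def using sum \<epsilon> by (intro finite_summable_superlevel) (auto simp: p_def)
  define H where "H s = {k \<in> Zstar m. norm_inf m k \<le> r s}" for s
  have sub: "G \<subseteq> (\<lambda>(s, k). (k, s)) ` (SIGMA s:F. H s)"
  proof
    fix q assume "q \<in> G"
    then obtain k s where q: "q = (k, s)" "k \<in> Zstar m" "s \<in> FS"
      and lt: "\<epsilon> * rho m \<alpha> b (k, s) < kappa m \<beta> (k, s)" by (auto simp: G_def)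
    have lt': "norm_inf m k < r s" using threshold_iff[where b = b, OF m ab b \<epsilon> q(2)] lt by (simp add: r_def)
    have "1 < r s" using norm_inf_ge_1[OF m q(2)] lt' by simp
    hence "1 \<le> multinom b s powr p * \<epsilon> powr (- p)" unfolding rm[symmetric] by (simp add: one_le_power)
    hence "\<epsilon> powr p \<le> multinom b s powr p" using \<epsilon> by (simp add: powr_minus field_simps)
    hence "s \<in> F" using q by (simp add: F_def)
    thus "q \<in> (\<lambda>(s, k). (k, s)) ` (SIGMA s:F. H s)"
      using q lt' by (intro image_eqI[of _ _ "(s, k)"]) (auto simp: H_def)
  qed
  have finH: "finite (H s)" for s unfolding H_def by (rule card_norm_inf_le(1)[OF m])
  have finS: "finite (SIGMA s:F. H s)" using F finH by blast
  show "finite G" by (rule finite_subset[OF sub]) (use finS in simp)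
  have "card G \<le> card ((\<lambda>(s, k). (k, s)) ` (SIGMA s:F. H s))"
    by (rule card_mono) (use sub finS in auto)
  also have "\<dots> \<le> card (SIGMA s:F. H s)" by (rule card_image_le[OF finS])
  also have "\<dots> = (\<Sum>s\<in>F. card (H s))" using F finH by simp
  finally have "real (card G) \<le> (\<Sum>s\<in>F. real (card (H s)))" by (simp flip: of_nat_sum)
  also have "\<dots> \<le> (\<Sum>s\<in>F. 2 ^ m * (multinom b s powr p * \<epsilon> powr (- p)))"
  proof (rule sum_mono)
    fix s
    have "real (card (H s)) = 2 ^ m * real (nat \<lfloor>r s\<rfloor>) ^ m"
      unfolding H_def card_norm_inf_le(2)[OF m] by (simp add: power_mult_distrib)
    also have "\<dots> \<le> 2 ^ m * r s ^ m"
      by (intro mult_left_mono power_mono) (auto simp: r_def)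
    finally show "real (card (H s)) \<le> 2 ^ m * (multinom b s powr p * \<epsilon> powr (- p))"
      unfolding rm .
  qed
  also have "\<dots> = 2 ^ m * \<epsilon> powr (- p) * (\<Sum>s\<in>F. multinom b s powr p)"
    by (simp add: sum_distrib_left mult_ac)
  also have "\<dots> \<le> 2 ^ m * \<epsilon> powr (- p) * (\<Sum>\<^sub>\<infinity>s\<in>FS. multinom b s powr p)"
    using sum F by (intro mult_left_mono finite_sum_le_infsum) (auto simp: F_def p_def)
  finally show "real (card G) \<le> 2 ^ m * (\<Sum>\<^sub>\<infinity>s\<in>FS. multinom b s powr (real m / (\<alpha> - \<beta>))) * \<epsilon> powr (- real m / (\<alpha> - \<beta>))"
    by (simp add: p_def mult_ac)
qed

text \<open>
  For \<open>s = 0\<close> the condition reads \<open>|k| < x = \<epsilon>^(-1/a)\<close> with \<open>a = \<alpha> - \<beta>\<close>. It is strict, so that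
  \<open>|k| \<le> \<lfloor>x\<rfloor>\<close> would not suffice if \<open>x\<close> is an integer, while \<open>|k| \<le> \<lfloor>x\<rfloor> - 1\<close> always does.
\<close>

lemma card_threshold_ge:
  fixes m :: nat and \<alpha> \<beta> \<epsilon> :: real and b :: "nat \<Rightarrow> real"
  assumes m: "m \<ge> 1" and ab: "\<alpha> > \<beta>" and b: "\<And>j. b j > 0" and \<epsilon>: "0 < \<epsilon>" "\<epsilon> \<le> 1"
    and G: "finite G" "{p \<in> Zstar m \<times> {\<lambda>_. 0}. \<epsilon> * rho m \<alpha> b p < kappa m \<beta> p} \<subseteq> G"
  shows "2 ^ m * (real_of_int \<lfloor>\<epsilon> powr (- 1 / (\<alpha> - \<beta>))\<rfloor> - 1) ^ m \<le> real (card G)"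
proof -
  define x where "x = \<epsilon> powr (- 1 / (\<alpha> - \<beta>))"
  define r where "r = real_of_int \<lfloor>x\<rfloor> - 1"
  have one: "multinom b (\<lambda>_. 0) = 1" by (rule multinom_size_0) (auto simp: FS_def supp_def mi_size_def)
  have x': "x = (multinom b (\<lambda>_. 0) / \<epsilon>) powr (1 / (\<alpha> - \<beta>))"
    using \<epsilon> by (simp add: x_def one powr_divide powr_minus field_simps)
  have "x \<ge> 1" unfolding x' one using \<epsilon> ab by (intro ge_one_powr_ge_zero) auto
  hence fl: "\<lfloor>x\<rfloor> \<ge> 1" by (simp add: le_floor_iff)
  have "r < x" unfolding r_def by linarith
  have "(\<lambda>k. (k, \<lambda>_. 0)) ` {k \<in> Zstar m. norm_inf m k \<le> r} \<subseteq> G"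
  proof safe
    fix k assume k: "k \<in> Zstar m" "norm_inf m k \<le> r"
    hence "\<epsilon> * rho m \<alpha> b (k, \<lambda>_. 0) < kappa m \<beta> (k, \<lambda>_. 0)"
      using \<open>r < x\<close> threshold_iff[where b = b and s = "\<lambda>_. 0", OF m ab b \<epsilon>(1) k(1)] x' by simp
    thus "(k, \<lambda>_. 0) \<in> G" using k G(2) by auto
  qed
  hence "card ((\<lambda>k. (k, \<lambda>_ :: nat. 0 :: nat)) ` {k \<in> Zstar m. norm_inf m k \<le> r}) \<le> card G"
    by (intro card_mono G)
  also have "card ((\<lambda>k. (k, \<lambda>_ :: nat. 0 :: nat)) ` {k \<in> Zstar m. norm_inf m k \<le> r}) = (2 * nat \<lfloor>r\<rfloor>) ^ m"
    by (subst card_image) (auto simp: inj_on_def card_norm_inf_le(2)[OF m])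
  finally have "real ((2 * nat \<lfloor>r\<rfloor>) ^ m) \<le> real (card G)" by (simp only: of_nat_le_iff)
  moreover have "real (nat \<lfloor>r\<rfloor>) = r" using fl by (simp add: r_def)
  ultimately show ?thesis by (simp add: power_mult_distrib r_def x_def)
qed

section \<open>Bounds for the \<epsilon>-dimension\<close>

theorem theorem6p1:
  fixes m :: nat and \<alpha> \<beta> :: real and b :: "nat \<Rightarrow> real"
  assumes "m \<ge> 1" and "\<alpha> > \<beta>" and "\<beta> \<ge> 0"
    and "\<And>j. b j > 0"
    and "if real m / (\<alpha> - \<beta>) \<le> 1
         then summable b \<and> (\<Sum>j. b j) < 1 \<and> summable (\<lambda>j. b j powr (real m / (\<alpha> - \<beta>)))
         else summable b \<and> (\<Sum>j. b j) \<le> 1"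
  shows "(\<lambda>s. (fact (mi_size s) / mi_fact s * mi_pow b s) powr (real m / (\<alpha> - \<beta>))) summable_on FS
    \<and> (\<forall>s \<ge> 1. \<forall>\<epsilon>. 0 < \<epsilon> \<and> \<epsilon> \<le> 1 \<longrightarrow>
        ereal (2 ^ m * (real_of_int \<lfloor>\<epsilon> powr (- 1 / (\<alpha> - \<beta>))\<rfloor> - 1) ^ m)
          \<le> ereal_of_enat (eps_dim \<epsilon> (U_trunc m s \<alpha> b) (K_trunc m s \<beta>) (K_norm m \<beta>))
      \<and> eps_dim \<epsilon> (U_trunc m s \<alpha> b) (K_trunc m s \<beta>) (K_norm m \<beta>)
          \<le> eps_dim \<epsilon> (U_ball m \<alpha> b) (K_space m \<beta>) (K_norm m \<beta>)
      \<and> ereal_of_enat (eps_dim \<epsilon> (U_ball m \<alpha> b) (K_space m \<beta>) (K_norm m \<beta>))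
          \<le> ereal (2 ^ m
              * ((3 / 2) ^ (2 * m)
                 * (\<Sum>\<^sub>\<infinity>s\<in>FS. (fact (mi_size s) / mi_fact s * mi_pow b s) powr (real m / (\<alpha> - \<beta>))))
              * \<epsilon> powr (- real m / (\<alpha> - \<beta>))))"
  unfolding multinom_def[symmetric]
proof (intro conjI allI impI)
  note m = assms(1) and ab = assms(2) and b = assms(4)
  show sum: "(\<lambda>s. multinom b s powr (real m / (\<alpha> - \<beta>))) summable_on FS"
  proof (cases "real m / (\<alpha> - \<beta>) \<le> 1")
    case True
    moreover have "real m / (\<alpha> - \<beta>) > 0" using m ab by simp
    ultimately show ?thesis using assms(5) b by (intro multinom_powr_summable_le_1) simp_all
  next
    case False
    thus ?thesis using assms(5) b by (intro multinom_powr_summable_gt_1) simp_all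
  qed
  fix s :: nat and \<epsilon> :: real
  assume \<epsilon>: "0 < \<epsilon> \<and> \<epsilon> \<le> 1"
  define Is where "Is = {p \<in> Zstar m \<times> FS. supp (snd p) \<subseteq> {..<s}}"
  define G where "G = {p \<in> Zstar m \<times> FS. \<epsilon> * rho m \<alpha> b p < kappa m \<beta> p}"
  define Gs where "Gs = G \<inter> Is"
  have finG: "finite G"
    and cardG: "real (card G) \<le> 2 ^ m * (\<Sum>\<^sub>\<infinity>s\<in>FS. multinom b s powr (real m / (\<alpha> - \<beta>))) * \<epsilon> powr (- real m / (\<alpha> - \<beta>))"
    using card_threshold_le[where b = b and \<epsilon> = \<epsilon>, OF m ab b _ sum] \<epsilon> unfolding G_def by auto
  have finGs: "finite Gs" using finG by (simp add: Gs_def)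
  have GZ: "G \<subseteq> Zstar m \<times> FS" "Gs \<subseteq> Zstar m \<times> FS" by (auto simp: Gs_def G_def)
  have rho_pos: "rho m \<alpha> b p > 0" if "p \<in> Zstar m \<times> FS" for p
  proof (cases p)
    case (Pair k t)
    have "norm_inf m k \<ge> 1" using that Pair m by (intro norm_inf_ge_1) auto
    thus ?thesis using multinom_pos[of b t] b by (simp add: Pair rho_eq)
  qed
  have trunc: "trig_legendre_sum m Gs c \<in> L2_trunc m s" for c
    by (rule trig_legendre_sum_L2_trunc[OF finGs GZ(2)]) (auto simp: Gs_def Is_def)
  have ball: "eps_dim \<epsilon> (U_ball m \<alpha> b) (K_space m \<beta>) (K_norm m \<beta>) = enat (card G)"
  proof (rule antisym)
    show "eps_dim \<epsilon> (U_ball m \<alpha> b) (K_space m \<beta>) (K_norm m \<beta>) \<le> enat (card G)"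
    proof (rule eps_dim_le_card[where I = "Zstar m \<times> FS" and \<alpha> = \<alpha> and b = b])
      show "kappa m \<beta> p \<le> \<epsilon> * rho m \<alpha> b p" if "p \<in> Zstar m \<times> FS - G" for p
        using that by (auto simp: G_def not_less)
      show "trig_legendre_sum m G c \<in> K_space m \<beta>" for c
        by (rule trig_legendre_sum_K_space[OF finG GZ(1)])
    qed (use \<epsilon> finG GZ in \<open>auto simp: U_ball_def\<close>)
    show "enat (card G) \<le> eps_dim \<epsilon> (U_ball m \<alpha> b) (K_space m \<beta>) (K_norm m \<beta>)"
    proof (rule card_le_eps_dim[where \<alpha> = \<alpha> and b = b, OF finG GZ(1)])
      show "0 < rho m \<alpha> b p \<and> \<epsilon> * rho m \<alpha> b p < kappa m \<beta> p" if "p \<in> G" for p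
        using that rho_pos[of p] by (simp add: G_def)
      show "trig_legendre_sum m G c \<in> U_ball m \<alpha> b" if "A_norm m \<alpha> b (trig_legendre_sum m G c) \<le> 1" for c
        using that trig_legendre_sum_A_space[OF finG GZ(1)] by (simp add: U_ball_def)
    qed (use \<epsilon> in auto)
  qed
  have truncated: "eps_dim \<epsilon> (U_trunc m s \<alpha> b) (K_trunc m s \<beta>) (K_norm m \<beta>) = enat (card Gs)"
  proof (rule antisym)
    show "eps_dim \<epsilon> (U_trunc m s \<alpha> b) (K_trunc m s \<beta>) (K_norm m \<beta>) \<le> enat (card Gs)"
    proof (rule eps_dim_le_card[where I = Is and \<alpha> = \<alpha> and b = b])
      show "kappa m \<beta> p \<le> \<epsilon> * rho m \<alpha> b p" if "p \<in> Is - Gs" for p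
        using that by (auto simp: Gs_def G_def Is_def not_less)
      show "trig_legendre_sum m Gs c \<in> K_trunc m s \<beta>" for c
        using trunc trig_legendre_sum_K_space[OF finGs GZ(2)] by (simp add: K_trunc_def)
      fix w assume w: "w \<in> U_trunc m s \<alpha> b"
      have "coeff m w p = 0" if "p \<in> Zstar m \<times> FS - Is" for p
        using that w coeff_eq_0_if_trunc[of w m s "fst p" "snd p"]
        by (auto simp: Is_def U_trunc_def A_trunc_def)
      thus "w \<in> A_space m \<alpha> b \<and> A_norm m \<alpha> b w \<le> 1 \<and> (\<forall>p\<in>Zstar m \<times> FS - Is. coeff m w p = 0)"
        using w by (simp add: U_trunc_def A_trunc_def)
    qed (use \<epsilon> finGs in \<open>auto simp: Is_def Gs_def\<close>)
    show "enat (card Gs) \<le> eps_dim \<epsilon> (U_trunc m s \<alpha> b) (K_trunc m s \<beta>) (K_norm m \<beta>)"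
    proof (rule card_le_eps_dim[where \<alpha> = \<alpha> and b = b, OF finGs GZ(2)])
      show "0 < rho m \<alpha> b p \<and> \<epsilon> * rho m \<alpha> b p < kappa m \<beta> p" if "p \<in> Gs" for p
        using that rho_pos[of p] by (simp add: G_def Gs_def)
      show "trig_legendre_sum m Gs c \<in> U_trunc m s \<alpha> b" if "A_norm m \<alpha> b (trig_legendre_sum m Gs c) \<le> 1" for c
        using that trunc trig_legendre_sum_A_space[OF finGs GZ(2)] by (simp add: U_trunc_def A_trunc_def)
    qed (use \<epsilon> in \<open>auto simp: K_trunc_def\<close>)
  qed
  have "2 ^ m * (real_of_int \<lfloor>\<epsilon> powr (- 1 / (\<alpha> - \<beta>))\<rfloor> - 1) ^ m \<le> real (card Gs)"
    using \<epsilon> finGs by (intro card_threshold_ge[where b = b, OF m ab b]) (auto simp: Gs_def G_def Is_def FS_def supp_def)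
  thus "ereal (2 ^ m * (real_of_int \<lfloor>\<epsilon> powr (- 1 / (\<alpha> - \<beta>))\<rfloor> - 1) ^ m)
      \<le> ereal_of_enat (eps_dim \<epsilon> (U_trunc m s \<alpha> b) (K_trunc m s \<beta>) (K_norm m \<beta>))"
    by (simp add: truncated)
  show "eps_dim \<epsilon> (U_trunc m s \<alpha> b) (K_trunc m s \<beta>) (K_norm m \<beta>)
      \<le> eps_dim \<epsilon> (U_ball m \<alpha> b) (K_space m \<beta>) (K_norm m \<beta>)"
    using finG by (simp add: truncated ball Gs_def card_mono)
  have "0 \<le> (\<Sum>\<^sub>\<infinity>s\<in>FS. multinom b s powr (real m / (\<alpha> - \<beta>)))" by (intro infsum_nonneg) simp
  hence "2 ^ m * (\<Sum>\<^sub>\<infinity>s\<in>FS. multinom b s powr (real m / (\<alpha> - \<beta>))) * \<epsilon> powr (- real m / (\<alpha> - \<beta>))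
      \<le> 2 ^ m * ((3 / 2) ^ (2 * m) * (\<Sum>\<^sub>\<infinity>s\<in>FS. multinom b s powr (real m / (\<alpha> - \<beta>))))
         * \<epsilon> powr (- real m / (\<alpha> - \<beta>))"
    by (intro mult_right_mono mult_left_mono) (auto intro!: mult_le_cancel_right1[THEN iffD2] one_le_power)
  with cardG have "real (card G)
      \<le> 2 ^ m * ((3 / 2) ^ (2 * m) * (\<Sum>\<^sub>\<infinity>s\<in>FS. multinom b s powr (real m / (\<alpha> - \<beta>))))
         * \<epsilon> powr (- real m / (\<alpha> - \<beta>))"
    by (rule order_trans)
  thus "ereal_of_enat (eps_dim \<epsilon> (U_ball m \<alpha> b) (K_space m \<beta>) (K_norm m \<beta>))
      \<le> ereal (2 ^ m * ((3 / 2) ^ (2 * m) * (\<Sum>\<^sub>\<infinity>s\<in>FS. multinom b s powr (real m / (\<alpha> - \<beta>))))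
         * \<epsilon> powr (- real m / (\<alpha> - \<beta>)))"
    unfolding ball by simp
qed

end
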